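(* Let $M$ be a Riemannian surface in the Minkowski space-time $\mathbb E^4_1$ lying on $\mathcal{LC}^2\times\mathbb R$, with frame field $\{e_1,e_2;\theta,\xi\}$ and functions $\alpha,\beta$ as in the context, where $\alpha$ vanishes at no point of $M$. Then the following are equivalent: (1) $M$ is pseudo-umbilical. (2) $e_1(\alpha)+\alpha^2=e_2(\alpha)=\beta=0$. (3) $M$ is flat, marginally trapped and has flat normal bundle. (4) The mean curvature vector field $H$ of $M$ satisfies $A_H=0$.
   Context: $\mathbb E^{m}_1$ is $\mathbb R^m$ with the metric $\langle\cdot,\cdot\rangle=-dx_1^2+\sum_{i=2}^m dx_i^2$; a vector $v$ is light-like if $\langle v,v\rangle=0$, $v\neq0$. $\mathcal{LC}^2\times\mathbb R=\{x\in\mathbb E^4_1: -x_1^2+x_2^2+x_3^2=0,\ x_1>0\}$. For a Riemannian surface $M$, $h$, $A$, $\nabla^\perp$ denote the second fundamental form, shape operator and normal connection ($\widetilde\nabla_XY=\nabla_XY+h(X,Y)$, $\widetilde\nabla_X\zeta=-A_\zeta X+\nabla^\perp_X\zeta$), and $H=\frac12\mathrm{trace}\,h$. $M$ is pseudo-umbilical if there is a smooth $f$ with $\langle A_HX,Y\rangle=f\langle X,Y\rangle$ for all tangent $X,Y$; marginally trapped if $H$ is light-like at every point; flat if its Gaussian curvature vanishes identically; it has flat normal bundle if the curvature tensor of $\nabla^\perp$ vanishes. Frame and invariants. Let $\phi=(\phi_1,\phi_2,\phi_3,\phi_4)$ be the position vector of $M$. Put $\theta=(\phi_1,\phi_2,\phi_3,0)$,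 a light-like normal field, and let $\xi$ be the normal field with $\langle\xi,\xi\rangle=0$, $\langle\xi,\theta\rangle=-1$. Let $e_1=(\partial_{x_4})^T$ be the tangential part of $\partial_{x_4}$ (a unit vector field), $e_2$ a unit tangent field orthogonal to $e_1$, $\alpha\in C^\infty(M)$ the function with $\nabla^\perp_{e_1}\theta=\alpha\theta$ (equivalently $\partial_{x_4}|_M=e_1-\alpha\theta$), and $\beta=\langle A_\xi e_2,e_2\rangle$. *)

theory Defs
  imports "HOL-Analysis.Analysis"
begin

definition mink :: "real^4 \<Rightarrow> real^4 \<Rightarrow> real" where
  "mink u v = - (u$1 * v$1) + u$2 * v$2 + u$3 * v$3 + u$4 * v$4"

definition light_like :: "real^4 \<Rightarrow> bool" where
  "light_like v \<longleftrightarrow> mink v v = 0 \<and> v \<noteq> 0"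

definition LC2_times_R :: "(real^4) set" where
  "LC2_times_R = {x. - ((x$1)^2) + (x$2)^2 + (x$3)^2 = 0 \<and> x$1 > 0}"

text \<open>Only meaningful on open sets: derivatives are taken in the full space.\<close>

primrec Ck_on :: "nat \<Rightarrow> ('a::real_normed_vector \<Rightarrow> 'b::real_normed_vector) \<Rightarrow> 'a set \<Rightarrow> bool" where
  "Ck_on 0 f S \<longleftrightarrow> continuous_on S f"
| "Ck_on (Suc k) f S \<longleftrightarrow> (\<forall>x\<in>S. f differentiable (at x)) \<and>
     (\<forall>v. Ck_on k (\<lambda>x. frechet_derivative f (at x) v) S)"

definition smooth_on :: "('a::real_normed_vector \<Rightarrow> 'b::real_normed_vector) \<Rightarrow> 'a set \<Rightarrow> bool" where
  "smooth_on f S \<longleftrightarrow> (\<forall>k. Ck_on k f S)"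

text \<open>
  An abstract surface is given by its topology and an atlas, together with its position vector
  (not assumed injective, so immersed surfaces are covered). A chart is a pair \<open>(D, x)\<close> of an
  open set \<open>D\<close> of the plane and a local parametrization \<open>x\<close>, only relevant on \<open>D\<close>.
\<close>

record 'a surface =
  surf_top :: "'a topology"
  charts :: "((real^2) set \<times> (real^2 \<Rightarrow> 'a)) set"
  pos :: "'a \<Rightarrow> real^4"

definition points :: "'a surface \<Rightarrow> 'a set" where
  "points M = topspace (surf_top M)"

definition smooth_atlas :: "'a surface \<Rightarrow> bool" where
  "smooth_atlas M \<longleftrightarrow>
     Hausdorff_space (surf_top M) \<and> second_countable (surf_top M) \<and>
     (\<Union>(D, x)\<in>charts M. x ` D) = points M \<and>
     (\<forall>(D, x)\<in>charts M. open D \<and> openin (surf_top M) (x ` D) \<and>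
        homeomorphic_map (top_of_set D) (subtopology (surf_top M) (x ` D)) x) \<and>
     (\<forall>(D, x)\<in>charts M. \<forall>(E, y)\<in>charts M.
        smooth_on (inv_into E y \<circ> x) {u \<in> D. x u \<in> y ` E})"

definition smooth_map_on :: "'a surface \<Rightarrow> 'a set \<Rightarrow> ('a \<Rightarrow> 'b::real_normed_vector) \<Rightarrow> bool" where
  "smooth_map_on M U F \<longleftrightarrow> (\<forall>(D, x)\<in>charts M. smooth_on (F \<circ> x) {u \<in> D. x u \<in> U})"

definition charts_at :: "'a surface \<Rightarrow> 'a \<Rightarrow> ((real^2) set \<times> (real^2 \<Rightarrow> 'a)) set" where
  "charts_at M p = {(D, x). (D, x) \<in> charts M \<and> p \<in> x ` D}"

text \<open>The differential at \<open>p\<close> of a map defined near \<open>p\<close>, read in the chart \<open>c\<close>.\<close>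

definition chart_diff ::
    "(real^2) set \<times> (real^2 \<Rightarrow> 'a) \<Rightarrow> 'a \<Rightarrow> ('a \<Rightarrow> 'b::real_normed_vector) \<Rightarrow> real^2 \<Rightarrow> 'b" where
  "chart_diff c p F = (case c of (D, x) \<Rightarrow> frechet_derivative (F \<circ> x) (at (inv_into D x p)))"

text \<open>Positive definiteness of the induced metric includes that the position vector is an immersion.\<close>

definition riemannian_surface :: "'a surface \<Rightarrow> bool" where
  "riemannian_surface M \<longleftrightarrow>
     smooth_atlas M \<and> smooth_map_on M (points M) (pos M) \<and>
     (\<forall>p\<in>points M. \<forall>c\<in>charts_at M p. \<forall>a. a \<noteq> 0 \<longrightarrow>
        mink (chart_diff c p (pos M) a) (chart_diff c p (pos M) a) > 0)"

text \<open>
  Tangent vectors are identified with their images under the differential of the position vector,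
  so tangent and normal fields are maps from the surface into \<open>real^4\<close>.
\<close>

definition tangent_space :: "'a surface \<Rightarrow> 'a \<Rightarrow> (real^4) set" where
  "tangent_space M p = {chart_diff c p (pos M) a | c a. c \<in> charts_at M p}"

text \<open>
  Derivative at \<open>p\<close> of \<open>F\<close> along the tangent vector \<open>v\<close>. By the chain rule it does not depend on the
  chart. For a field \<open>F\<close> with values in \<open>real^4\<close> it is the covariant derivative of the ambient space.
\<close>

definition dir_deriv :: "'a surface \<Rightarrow> 'a \<Rightarrow> real^4 \<Rightarrow> ('a \<Rightarrow> 'b::real_normed_vector) \<Rightarrow> 'b" where
  "dir_deriv M p v F = (THE d. \<exists>c\<in>charts_at M p. \<exists>a.
     v = chart_diff c p (pos M) a \<and> d = chart_diff c p F a)"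

definition tan_part :: "'a surface \<Rightarrow> 'a \<Rightarrow> real^4 \<Rightarrow> real^4" where
  "tan_part M p w = (THE t. t \<in> tangent_space M p \<and> (\<forall>v\<in>tangent_space M p. mink (w - t) v = 0))"

definition nor_part :: "'a surface \<Rightarrow> 'a \<Rightarrow> real^4 \<Rightarrow> real^4" where
  "nor_part M p w = w - tan_part M p w"

definition tangent_field :: "'a surface \<Rightarrow> 'a set \<Rightarrow> ('a \<Rightarrow> real^4) \<Rightarrow> bool" where
  "tangent_field M U X \<longleftrightarrow> smooth_map_on M U X \<and> (\<forall>p\<in>U. X p \<in> tangent_space M p)"

definition normal_field :: "'a surface \<Rightarrow> 'a set \<Rightarrow> ('a \<Rightarrow> real^4) \<Rightarrow> bool" where
  "normal_field M U \<zeta> \<longleftrightarrow> smooth_map_on M U \<zeta> \<and>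
     (\<forall>p\<in>U. \<forall>v\<in>tangent_space M p. mink (\<zeta> p) v = 0)"

definition orthonormal_frame ::
    "'a surface \<Rightarrow> 'a set \<Rightarrow> ('a \<Rightarrow> real^4) \<Rightarrow> ('a \<Rightarrow> real^4) \<Rightarrow> bool" where
  "orthonormal_frame M U E1 E2 \<longleftrightarrow> tangent_field M U E1 \<and> tangent_field M U E2 \<and>
     (\<forall>p\<in>U. mink (E1 p) (E1 p) = 1 \<and> mink (E2 p) (E2 p) = 1 \<and> mink (E1 p) (E2 p) = 0)"

definition conn :: "'a surface \<Rightarrow> ('a \<Rightarrow> real^4) \<Rightarrow> ('a \<Rightarrow> real^4) \<Rightarrow> 'a \<Rightarrow> real^4" where
  "conn M X Y p = tan_part M p (dir_deriv M p (X p) Y)"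

definition second_ff :: "'a surface \<Rightarrow> ('a \<Rightarrow> real^4) \<Rightarrow> ('a \<Rightarrow> real^4) \<Rightarrow> 'a \<Rightarrow> real^4" where
  "second_ff M X Y p = nor_part M p (dir_deriv M p (X p) Y)"

definition shape_op :: "'a surface \<Rightarrow> ('a \<Rightarrow> real^4) \<Rightarrow> 'a \<Rightarrow> real^4 \<Rightarrow> real^4" where
  "shape_op M \<zeta> p v = - tan_part M p (dir_deriv M p v \<zeta>)"

definition normal_conn :: "'a surface \<Rightarrow> ('a \<Rightarrow> real^4) \<Rightarrow> ('a \<Rightarrow> real^4) \<Rightarrow> 'a \<Rightarrow> real^4" where
  "normal_conn M X \<zeta> p = nor_part M p (dir_deriv M p (X p) \<zeta>)"

text \<open>
  The trace of the second fundamental form at \<open>p\<close> is computed in an orthonormal frame near \<open>p\<close>; it is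
  the same for all such frames.
\<close>

definition mean_curv :: "'a surface \<Rightarrow> 'a \<Rightarrow> real^4" where
  "mean_curv M p = (THE \<eta>. \<exists>U E1 E2. openin (surf_top M) U \<and> p \<in> U \<and>
     orthonormal_frame M U E1 E2 \<and>
     \<eta> = (1/2) *\<^sub>R (second_ff M E1 E1 p + second_ff M E2 E2 p))"

text \<open>The commutator of \<open>X\<close> and \<open>Y\<close> as derivations on germs of smooth functions.\<close>

definition lie_bracket :: "'a surface \<Rightarrow> ('a \<Rightarrow> real^4) \<Rightarrow> ('a \<Rightarrow> real^4) \<Rightarrow> 'a \<Rightarrow> real^4" where
  "lie_bracket M X Y p = (THE v. v \<in> tangent_space M p \<and>
     (\<forall>U (f :: 'a \<Rightarrow> real). openin (surf_top M) U \<and> p \<in> U \<and> smooth_map_on M U f \<longrightarrow>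
        dir_deriv M p v f =
          dir_deriv M p (X p) (\<lambda>q. dir_deriv M q (Y q) f) -
          dir_deriv M p (Y p) (\<lambda>q. dir_deriv M q (X q) f)))"

definition riem_curv ::
    "'a surface \<Rightarrow> ('a \<Rightarrow> real^4) \<Rightarrow> ('a \<Rightarrow> real^4) \<Rightarrow> ('a \<Rightarrow> real^4) \<Rightarrow> 'a \<Rightarrow> real^4" where
  "riem_curv M X Y Z p = conn M X (conn M Y Z) p - conn M Y (conn M X Z) p
     - conn M (lie_bracket M X Y) Z p"

definition normal_curv ::
    "'a surface \<Rightarrow> ('a \<Rightarrow> real^4) \<Rightarrow> ('a \<Rightarrow> real^4) \<Rightarrow> ('a \<Rightarrow> real^4) \<Rightarrow> 'a \<Rightarrow> real^4" where
  "normal_curv M X Y \<zeta> p = normal_conn M X (normal_conn M Y \<zeta>) p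
     - normal_conn M Y (normal_conn M X \<zeta>) p - normal_conn M (lie_bracket M X Y) \<zeta> p"

definition gauss_curv :: "'a surface \<Rightarrow> 'a \<Rightarrow> real" where
  "gauss_curv M p = (THE K. \<exists>U E1 E2. openin (surf_top M) U \<and> p \<in> U \<and>
     orthonormal_frame M U E1 E2 \<and> K = mink (riem_curv M E1 E2 E2 p) (E1 p))"

definition pseudo_umbilical :: "'a surface \<Rightarrow> bool" where
  "pseudo_umbilical M \<longleftrightarrow> (\<exists>f :: 'a \<Rightarrow> real. smooth_map_on M (points M) f \<and>
     (\<forall>p\<in>points M. \<forall>v\<in>tangent_space M p. \<forall>w\<in>tangent_space M p.
        mink (shape_op M (mean_curv M) p v) w = f p * mink v w))"

definition marginally_trapped :: "'a surface \<Rightarrow> bool" where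
  "marginally_trapped M \<longleftrightarrow> (\<forall>p\<in>points M. light_like (mean_curv M p))"

definition flat_surface :: "'a surface \<Rightarrow> bool" where
  "flat_surface M \<longleftrightarrow> (\<forall>p\<in>points M. gauss_curv M p = 0)"

definition flat_normal_bundle :: "'a surface \<Rightarrow> bool" where
  "flat_normal_bundle M \<longleftrightarrow> (\<forall>U X Y \<zeta>. openin (surf_top M) U \<and>
     tangent_field M U X \<and> tangent_field M U Y \<and> normal_field M U \<zeta> \<longrightarrow>
     (\<forall>p\<in>U. normal_curv M X Y \<zeta> p = 0))"

definition theta_field :: "'a surface \<Rightarrow> 'a \<Rightarrow> real^4" where
  "theta_field M p = (\<chi> i. if i = 4 then 0 else pos M p $ i)"

end

theory Submission
  imports Defs
begin

text \<open>
  The vector \<open>\<partial>\<^sub>4\<close> is constant in the ambient space and equals \<open>e1 - \<alpha> \<theta>\<close> along the surface.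
  Differentiating this single relation, and \<open>\<theta> = \<phi> - \<phi>\<^sub>4 \<partial>\<^sub>4\<close>, determines the moving frame: with
  \<open>\<epsilon> = e1(\<alpha>) + \<alpha>\<^sup>2\<close> and \<open>\<gamma> = e2(\<alpha>)\<close> one finds

  \<open>h(e1, e1) = \<epsilon> \<theta>\<close>, \<open>h(e1, e2) = \<gamma> \<theta>\<close>, \<open>h(e2, e2) = - \<beta> \<theta> + \<xi>\<close>,

  together with \<open>\<nabla>\<^sub>v e1 = \<alpha> \<langle>v, e2\<rangle> e2\<close> and the normal connection (lemmas \<open>theta_deriv\<close>, \<open>e1_deriv\<close>,
  \<open>e2_deriv\<close>, \<open>xi_deriv\<close>). All quantities in the theorem are then functions of
  \<open>\<epsilon>\<close>, \<open>\<gamma>\<close>, \<open>\<beta>\<close>: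

  \<^item> \<open>H = ((\<epsilon> - \<beta>) \<theta> + \<xi>) / 2\<close>, so \<open>\<langle>H, H\<rangle> = - (\<epsilon> - \<beta>) / 2\<close> and \<open>H\<close> never vanishes;
  \<^item> \<open>A\<^sub>H\<close> has the matrix \<open>- (\<epsilon>, \<gamma>; \<gamma>, \<epsilon> - 2 \<beta>) / 2\<close>;
  \<^item> the Gaussian curvature is \<open>- \<epsilon>\<close> (Gauss equation), and the normal curvature of \<open>\<theta>\<close> pairs with
    \<open>\<xi>\<close> to \<open>\<gamma>\<close> (Ricci equation).

  Hence conditions (2) and (3) both say \<open>\<epsilon> = \<gamma> = \<beta> = 0\<close>, which gives \<open>A\<^sub>H = 0\<close> and thus
  pseudo-umbilicity with factor \<open>0\<close>. Conversely, pseudo-umbilicity compares the entries of \<open>A\<^sub>H\<close> and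
  yields only \<open>\<gamma> = \<beta> = 0\<close>. The missing \<open>\<epsilon> = 0\<close> comes from the Codazzi equation, which for
  \<open>\<gamma> = \<beta> = 0\<close> reduces to \<open>\<alpha> \<epsilon> = 0\<close> (lemma \<open>codazzi\<close>), since \<open>\<alpha>\<close> has no zeros.

  The analytic basis is one fact: the directional derivatives of a smooth map along smooth tangent
  fields \<open>X\<close>, \<open>Y\<close> commute up to the derivative along the tangent vector \<open>D\<^sub>X Y - D\<^sub>Y X\<close>
  (lemma \<open>dir_deriv_commute\<close>). It rests on the symmetry of second derivatives and on the
  differentiability of the components of a tangent field in a chart. It gives the symmetry of \<open>h\<close>,
  the Lie bracket, and the equations of Gauss, Codazzi and Ricci.
\<close>

section \<open>Calculus of several variables\<close>

lemma Ck_on_subset: "Ck_on k f S \<Longrightarrow> T \<subseteq> S \<Longrightarrow> Ck_on k f T"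
proof (induction k arbitrary: f)
  case 0
  then show ?case by (auto intro: continuous_on_subset)
next
  case (Suc k)
  then show ?case by (auto simp: subset_eq)
qed

lemma Ck_on_cong:
  assumes "open S" "\<And>x. x \<in> S \<Longrightarrow> f x = g x" "Ck_on k f S"
  shows "Ck_on k g S"
  using assms(2,3)
proof (induction k arbitrary: f g)
  case 0
  then show ?case by (simp cong: continuous_on_cong)
next
  case (Suc k)
  have d: "f differentiable (at x)" if "x \<in> S" for x
    using Suc.prems that by auto
  have "g differentiable (at x)" if "x \<in> S" for x
    using d[OF that] Suc.prems(1) assms(1) that
    by (metis differentiable_def has_derivative_transform_within_open)
  moreover have "frechet_derivative f (at x) = frechet_derivative g (at x)" if "x \<in> S" for x
    using frechet_derivative_transform_within_open[OF d[OF that] assms(1) that] Suc.prems(1) by blast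
  then have "Ck_on k (\<lambda>x. frechet_derivative g (at x) v) S" for v
    using Suc.IH[of "\<lambda>x. frechet_derivative f (at x) v" "\<lambda>x. frechet_derivative g (at x) v"]
      Suc.prems(2) by auto
  ultimately show ?case by auto
qed

lemma Ck_on_SucD: "Ck_on (Suc k) f S \<Longrightarrow> Ck_on k f S"
proof (induction k arbitrary: f)
  case 0
  then show ?case
    by (auto intro!: continuous_at_imp_continuous_on differentiable_imp_continuous_within)
next
  case (Suc k)
  then show ?case by (metis Ck_on.simps(2))
qed

lemma Ck_on_const: "Ck_on k (\<lambda>x. c) S"
proof (induction k arbitrary: c)
  case (Suc k)
  have "frechet_derivative (\<lambda>x. c) (at x) = (\<lambda>v. 0)" for x :: 'a
    by (rule frechet_derivative_at[symmetric]) simp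
  then show ?case using Suc by auto
qed simp

lemma Ck_on_bounded_linear:
  assumes "open S" "bounded_linear L" "Ck_on k f S"
  shows "Ck_on k (\<lambda>x. L (f x)) S"
  using assms(3)
proof (induction k arbitrary: f)
  case 0
  then show ?case by (simp add: bounded_linear.continuous_on[OF assms(2)])
next
  case (Suc k)
  have D: "((\<lambda>x. L (f x)) has_derivative (\<lambda>v. L (frechet_derivative f (at x) v))) (at x)"
    if "x \<in> S" for x
    using Suc.prems that
    by (auto intro!: bounded_linear.has_derivative[OF assms(2)] simp: frechet_derivative_works[symmetric])
  have "Ck_on k (\<lambda>x. frechet_derivative (\<lambda>x. L (f x)) (at x) v) S" for v
    by (rule Ck_on_cong[OF assms(1) _ Suc.IH[of "\<lambda>x. frechet_derivative f (at x) v"]])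
      (use Suc.prems frechet_derivative_at[OF D] in \<open>auto dest: fun_cong\<close>)
  moreover have "(\<lambda>x. L (f x)) differentiable (at x)" if "x \<in> S" for x
    using D[OF that] by (auto simp: differentiable_def)
  ultimately show ?case by auto
qed

lemma Ck_on_add:
  assumes "open S" "Ck_on k f S" "Ck_on k g S"
  shows "Ck_on k (\<lambda>x. f x + g x) S"
  using assms(2,3)
proof (induction k arbitrary: f g)
  case 0
  then show ?case by (simp add: continuous_on_add)
next
  case (Suc k)
  have D: "((\<lambda>x. f x + g x) has_derivative
      (\<lambda>v. frechet_derivative f (at x) v + frechet_derivative g (at x) v)) (at x)"
    if "x \<in> S" for x
    using Suc.prems that
    by (auto intro!: has_derivative_add simp: frechet_derivative_works[symmetric])
  have "Ck_on k (\<lambda>x. frechet_derivative (\<lambda>x. f x + g x) (at x) v) S" for v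
    by (rule Ck_on_cong[OF assms(1) _ Suc.IH[of "\<lambda>x. frechet_derivative f (at x) v"
          "\<lambda>x. frechet_derivative g (at x) v"]])
      (use Suc.prems frechet_derivative_at[OF D] in \<open>auto dest: fun_cong\<close>)
  moreover have "(\<lambda>x. f x + g x) differentiable (at x)" if "x \<in> S" for x
    using D[OF that] by (auto simp: differentiable_def)
  ultimately show ?case by auto
qed

lemma Ck_on_bilinear:
  assumes "open S" "bounded_bilinear B" "Ck_on k f S" "Ck_on k g S"
  shows "Ck_on k (\<lambda>x. B (f x) (g x)) S"
  using assms(3,4)
proof (induction k arbitrary: f g)
  case 0
  then show ?case by (simp add: bounded_bilinear.continuous_on[OF assms(2)])
next
  case (Suc k)
  have D: "((\<lambda>x. B (f x) (g x)) has_derivative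
      (\<lambda>v. B (f x) (frechet_derivative g (at x) v) + B (frechet_derivative f (at x) v) (g x))) (at x)"
    if "x \<in> S" for x
    using Suc.prems that
    by (auto intro!: bounded_bilinear.FDERIV[OF assms(2)] simp: frechet_derivative_works[symmetric])
  have "Ck_on k (\<lambda>x. frechet_derivative (\<lambda>x. B (f x) (g x)) (at x) v) S" for v
  proof (rule Ck_on_cong[OF assms(1) _ Ck_on_add[OF assms(1)]])
    show "Ck_on k (\<lambda>x. B (f x) (frechet_derivative g (at x) v)) S"
      "Ck_on k (\<lambda>x. B (frechet_derivative f (at x) v) (g x)) S"
      using Suc.prems Suc.IH Ck_on_SucD[of k f] Ck_on_SucD[of k g] by auto
  qed (use frechet_derivative_at[OF D] in \<open>auto dest: fun_cong\<close>)
  moreover have "(\<lambda>x. B (f x) (g x)) differentiable (at x)" if "x \<in> S" for x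
    using D[OF that] by (auto simp: differentiable_def)
  ultimately show ?case by auto
qed

text \<open>
  The mean value theorem is applied once to the increment in direction \<open>a\<close> of the difference
  \<open>f (x + t b) - f x\<close>, and then to the increment of the derivative in direction \<open>b\<close>.
\<close>

lemma second_difference_mean_value:
  fixes f :: "'a::real_normed_vector \<Rightarrow> real"
  assumes t: "t > 0" and B: "\<And>r s. 0 \<le> r \<Longrightarrow> r \<le> t \<Longrightarrow> 0 \<le> s \<Longrightarrow> s \<le> t \<Longrightarrow> u + r *\<^sub>R a + s *\<^sub>R b \<in> S"
    and f: "\<And>x. x \<in> S \<Longrightarrow> f differentiable (at x)"
    and fa: "\<And>x. x \<in> S \<Longrightarrow> (\<lambda>x. frechet_derivative f (at x) a) differentiable (at x)"
  shows "\<exists>r s. 0 < r \<and> r < t \<and> 0 < s \<and> s < t \<and>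
    f (u + t *\<^sub>R a + t *\<^sub>R b) - f (u + t *\<^sub>R a) - f (u + t *\<^sub>R b) + f u =
      t * t * frechet_derivative (\<lambda>x. frechet_derivative f (at x) a) (at (u + r *\<^sub>R a + s *\<^sub>R b)) b"
proof -
  let ?fa = "\<lambda>x. frechet_derivative f (at x) a"
  have lin: "((\<lambda>r. g (y + r *\<^sub>R c)) has_real_derivative frechet_derivative g (at (y + r *\<^sub>R c)) c) (at r)"
    if "g differentiable (at (y + r *\<^sub>R c))" for g :: "'a \<Rightarrow> real" and y c r
  proof -
    have g: "(g has_derivative frechet_derivative g (at (y + r *\<^sub>R c))) (at (y + r *\<^sub>R c))"
      using that by (simp add: frechet_derivative_works)
    have "((\<lambda>r. g (y + r *\<^sub>R c)) has_derivative
        (\<lambda>h. frechet_derivative g (at (y + r *\<^sub>R c)) (h *\<^sub>R c))) (at r)"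
      by (rule has_derivative_compose[where g = g and f = "\<lambda>r. y + r *\<^sub>R c", OF _ g]) (auto intro!: derivative_eq_intros)
    then show ?thesis
      using linear_frechet_derivative[OF that]
      by (simp add: has_field_derivative_def linear_cmul mult.commute[of _ "frechet_derivative _ _ _"])
  qed
  have "\<exists>r. 0 < r \<and> r < t \<and>
     (f (u + t *\<^sub>R b + t *\<^sub>R a) - f (u + t *\<^sub>R a)) - (f (u + t *\<^sub>R b + 0 *\<^sub>R a) - f (u + 0 *\<^sub>R a)) =
       (t - 0) * (?fa (u + t *\<^sub>R b + r *\<^sub>R a) - ?fa (u + r *\<^sub>R a))"
  proof (rule MVT2[OF t], goal_cases)
    case (1 r)
    have "u + t *\<^sub>R b + r *\<^sub>R a \<in> S" "u + r *\<^sub>R a \<in> S"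
      using B[of r t] B[of r 0] 1 t by (auto simp: ac_simps)
    then show ?case by (intro DERIV_diff lin f)
  qed
  then obtain r where r: "0 < r" "r < t" and
    e1: "f (u + t *\<^sub>R a + t *\<^sub>R b) - f (u + t *\<^sub>R a) - f (u + t *\<^sub>R b) + f u =
      t * (?fa (u + r *\<^sub>R a + t *\<^sub>R b) - ?fa (u + r *\<^sub>R a))"
    by (auto simp: ac_simps algebra_simps)
  have "\<exists>s. 0 < s \<and> s < t \<and> ?fa ((u + r *\<^sub>R a) + t *\<^sub>R b) - ?fa ((u + r *\<^sub>R a) + 0 *\<^sub>R b) =
       (t - 0) * frechet_derivative ?fa (at ((u + r *\<^sub>R a) + s *\<^sub>R b)) b"
    by (rule MVT2[OF t], rule lin, rule fa, rule B) (use r in auto)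
  then show ?thesis using r e1 by auto
qed

text \<open>
  Schwarz's theorem. The second difference is symmetric in \<open>a\<close> and \<open>b\<close>, so a value of one mixed
  derivative near \<open>u\<close> is also a value of the other near \<open>u\<close>; continuity at \<open>u\<close> does the rest.
\<close>

lemma mixed_derivatives_commute_real:
  fixes f :: "'a::real_normed_vector \<Rightarrow> real"
  assumes S: "open S" "u \<in> S" and f: "Ck_on 2 f S"
  shows "frechet_derivative (\<lambda>x. frechet_derivative f (at x) a) (at u) b =
    frechet_derivative (\<lambda>x. frechet_derivative f (at x) b) (at u) a"
proof -
  define P where "P = (\<lambda>x. frechet_derivative (\<lambda>x. frechet_derivative f (at x) a) (at x) b)"
  define Q where "Q = (\<lambda>x. frechet_derivative (\<lambda>x. frechet_derivative f (at x) b) (at x) a)"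
  have f1: "f differentiable (at x)" if "x \<in> S" for x
    using f that by (auto simp: numeral_2_eq_2)
  have f2: "(\<lambda>x. frechet_derivative f (at x) c) differentiable (at x)" if "x \<in> S" for x c
    using f that by (auto simp: numeral_2_eq_2)
  have "continuous_on S P" "continuous_on S Q"
    using f unfolding P_def Q_def by (auto simp: numeral_2_eq_2)
  then have cont: "isCont P u" "isCont Q u"
    using S by (auto simp: continuous_on_eq_continuous_at)
  have "\<bar>P u - Q u\<bar> \<le> 0"
  proof (rule field_le_epsilon)
    fix e :: real assume e: "e > 0"
    obtain d0 where d0: "d0 > 0" "ball u d0 \<subseteq> S"
      using S by (meson open_contains_ball)
    obtain d1 where d1: "d1 > 0" "\<And>x. dist x u < d1 \<Longrightarrow> \<bar>P x - P u\<bar> < e / 2"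
      using cont(1)[unfolded continuous_at_eps_delta, rule_format, of "e / 2"] e
      by (auto simp: dist_real_def)
    obtain d2 where d2: "d2 > 0" "\<And>x. dist x u < d2 \<Longrightarrow> \<bar>Q x - Q u\<bar> < e / 2"
      using cont(2)[unfolded continuous_at_eps_delta, rule_format, of "e / 2"] e
      by (auto simp: dist_real_def)
    \<comment> \<open>The step \<open>t\<close> is chosen such that the whole parallelogram spanned by \<open>t a\<close> and \<open>t b\<close> at \<open>u\<close>
      lies within distance \<open>d / 2\<close> of \<open>u\<close>.\<close>
    define d where "d = min d0 (min d1 d2)"
    define N where "N = norm a + norm b + 1"
    define t where "t = d / (2 * N)"
    have N: "N > 0" unfolding N_def by (smt (verit) norm_ge_zero)
    have d: "d > 0" using d0 d1 d2 by (simp add: d_def)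
    have t: "t > 0" using d N by (simp add: t_def)
    have near: "dist (u + r *\<^sub>R a + s *\<^sub>R b) u < d" if "0 \<le> r" "r \<le> t" "0 \<le> s" "s \<le> t" for r s
    proof -
      have "dist (u + r *\<^sub>R a + s *\<^sub>R b) u \<le> r * norm a + s * norm b"
        using that by (simp add: dist_norm add.assoc) (metis abs_of_nonneg norm_scaleR norm_triangle_ineq)
      also have "\<dots> \<le> t * norm a + t * norm b"
        using that by (intro add_mono mult_right_mono) auto
      also have "\<dots> \<le> t * N" using t by (simp add: N_def algebra_simps)
      also have "\<dots> = d / 2" using N by (simp add: t_def)
      also have "\<dots> < d" using d by simp
      finally show ?thesis .
    qed
    have inS: "x \<in> S" if "dist x u < d" for x
      using that d0 by (auto simp: d_def subset_eq dist_commute)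
    obtain r s where r: "0 < r" "r < t" "0 < s" "s < t" and
      e1: "f (u + t *\<^sub>R a + t *\<^sub>R b) - f (u + t *\<^sub>R a) - f (u + t *\<^sub>R b) + f u =
         t * t * P (u + r *\<^sub>R a + s *\<^sub>R b)"
      using second_difference_mean_value[of t u a b S f, OF t] inS near f1 f2 unfolding P_def by blast
    have near': "dist (u + r *\<^sub>R b + s *\<^sub>R a) u < d" if "0 \<le> r" "r \<le> t" "0 \<le> s" "s \<le> t" for r s
      using near[of s r] that by (simp add: ac_simps)
    obtain r' s' where r': "0 < r'" "r' < t" "0 < s'" "s' < t" and
      e2: "f (u + t *\<^sub>R b + t *\<^sub>R a) - f (u + t *\<^sub>R b) - f (u + t *\<^sub>R a) + f u =
         t * t * Q (u + r' *\<^sub>R b + s' *\<^sub>R a)"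
      using second_difference_mean_value[of t u b a S f, OF t] inS near' f1 f2 unfolding Q_def by blast
    have swap: "u + t *\<^sub>R b + t *\<^sub>R a = u + t *\<^sub>R a + t *\<^sub>R b" by simp
    have "t * t * P (u + r *\<^sub>R a + s *\<^sub>R b) = t * t * Q (u + r' *\<^sub>R b + s' *\<^sub>R a)"
      using e1 e2[unfolded swap] by linarith
    then have "P (u + r *\<^sub>R a + s *\<^sub>R b) = Q (u + r' *\<^sub>R b + s' *\<^sub>R a)"
      using t by simp
    moreover have "\<bar>P (u + r *\<^sub>R a + s *\<^sub>R b) - P u\<bar> < e / 2"
      using d1(2) near[of r s] r by (auto simp: d_def)
    moreover have "\<bar>Q (u + r' *\<^sub>R b + s' *\<^sub>R a) - Q u\<bar> < e / 2"
      using d2(2) near'[of r' s'] r' by (auto simp: d_def)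
    ultimately show "\<bar>P u - Q u\<bar> \<le> 0 + e" by linarith
  qed
  then show ?thesis by (simp add: P_def Q_def)
qed

lemma mixed_derivatives_commute:
  fixes f :: "'a::real_normed_vector \<Rightarrow> 'b::euclidean_space"
  assumes S: "open S" "u \<in> S" and f: "Ck_on 2 f S"
  shows "frechet_derivative (\<lambda>x. frechet_derivative f (at x) a) (at u) b =
    frechet_derivative (\<lambda>x. frechet_derivative f (at x) b) (at u) a"
proof (rule euclidean_eqI)
  fix i :: 'b assume "i \<in> Basis"
  have bl: "bounded_linear (\<lambda>y. y \<bullet> i)" by (rule bounded_linear_inner_left)
  have D: "frechet_derivative (\<lambda>x. g x \<bullet> i) (at x) c = frechet_derivative g (at x) c \<bullet> i"
    if "g differentiable (at x)" for g :: "'a \<Rightarrow> 'b" and x c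
    using frechet_derivative_at[OF bounded_linear.has_derivative[OF bl that[unfolded frechet_derivative_works]]]
    by metis
  have f1: "f differentiable (at x)" if "x \<in> S" for x
    using f that by (auto simp: numeral_2_eq_2)
  have f2: "(\<lambda>x. frechet_derivative f (at x) c) differentiable (at x)" if "x \<in> S" for x c
    using f that by (auto simp: numeral_2_eq_2)
  have "frechet_derivative (\<lambda>x. frechet_derivative f (at x) c) (at u) d \<bullet> i =
     frechet_derivative (\<lambda>x. frechet_derivative (\<lambda>x. f x \<bullet> i) (at x) c) (at u) d" for c d
  proof -
    have "frechet_derivative (\<lambda>x. frechet_derivative f (at x) c) (at u) d \<bullet> i =
      frechet_derivative (\<lambda>x. frechet_derivative f (at x) c \<bullet> i) (at u) d"
      using D[OF f2[OF S(2)]] by simp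
    also have "frechet_derivative (\<lambda>x. frechet_derivative f (at x) c \<bullet> i) (at u) =
      frechet_derivative (\<lambda>x. frechet_derivative (\<lambda>x. f x \<bullet> i) (at x) c) (at u)"
    proof (rule frechet_derivative_transform_within_open[OF _ S])
      show "(\<lambda>x. frechet_derivative f (at x) c \<bullet> i) differentiable at u"
        using f2[OF S(2)] by simp
    qed (use D f1 in simp)
    finally show ?thesis .
  qed
  with mixed_derivatives_commute_real[OF S Ck_on_bounded_linear[OF S(1) bl f]]
  show "frechet_derivative (\<lambda>x. frechet_derivative f (at x) a) (at u) b \<bullet> i =
    frechet_derivative (\<lambda>x. frechet_derivative f (at x) b) (at u) a \<bullet> i" by metis
qed

text \<open>
  Product rule for \<open>f'(w) (b w)\<close>: expanding \<open>b w\<close> in the basis reduces it to the differentiability of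
  each partial derivative of \<open>f\<close>, so that no operator norm on the space of derivatives is involved.
\<close>

lemma derivative_along_field:
  fixes f :: "'a::euclidean_space \<Rightarrow> 'b::real_normed_vector"
  assumes S: "open S" "u \<in> S" and f: "Ck_on 2 f S" and b: "b differentiable (at u)"
  shows "((\<lambda>w. frechet_derivative f (at w) (b w)) has_derivative
    (\<lambda>h. frechet_derivative (\<lambda>w. frechet_derivative f (at w) (b u)) (at u) h +
         frechet_derivative f (at u) (frechet_derivative b (at u) h))) (at u)"
proof -
  let ?D = "\<lambda>w. frechet_derivative f (at w)"
  have f1: "f differentiable (at w)" if "w \<in> S" for w
    using f that by (simp add: numeral_2_eq_2)
  have f2: "(\<lambda>w. ?D w k) differentiable (at w)" if "w \<in> S" for w k
    using f that by (simp add: numeral_2_eq_2)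
  have expand: "?D w k = (\<Sum>i\<in>Basis. (k \<bullet> i) *\<^sub>R ?D w i)" if "w \<in> S" for w k
  proof -
    note l = linear_frechet_derivative[OF f1[OF that]]
    have "?D w (\<Sum>i\<in>Basis. (k \<bullet> i) *\<^sub>R i) = (\<Sum>i\<in>Basis. (k \<bullet> i) *\<^sub>R ?D w i)"
      by (simp add: linear_sum[OF l] linear_cmul[OF l])
    then show ?thesis by (simp add: euclidean_representation)
  qed
  have D: "((\<lambda>w. ?D w (k w)) has_derivative
      (\<lambda>h. \<Sum>i\<in>Basis. (k u \<bullet> i) *\<^sub>R frechet_derivative (\<lambda>w. ?D w i) (at u) h + (k' h \<bullet> i) *\<^sub>R ?D u i)) (at u)"
    if k: "(k has_derivative k') (at u)" for k k'
  proof (rule has_derivative_transform_within_open[OF _ S])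
    show "((\<lambda>w. \<Sum>i\<in>Basis. (k w \<bullet> i) *\<^sub>R ?D w i) has_derivative
      (\<lambda>h. \<Sum>i\<in>Basis. (k u \<bullet> i) *\<^sub>R frechet_derivative (\<lambda>w. ?D w i) (at u) h + (k' h \<bullet> i) *\<^sub>R ?D u i)) (at u)"
    proof (rule has_derivative_sum)
      fix i :: 'a
      show "((\<lambda>w. (k w \<bullet> i) *\<^sub>R ?D w i) has_derivative
        (\<lambda>h. (k u \<bullet> i) *\<^sub>R frechet_derivative (\<lambda>w. ?D w i) (at u) h + (k' h \<bullet> i) *\<^sub>R ?D u i)) (at u)"
        by (rule has_derivative_scaleR[OF has_derivative_inner_left[OF k]
              f2[OF S(2), unfolded frechet_derivative_works]])
    qed
  qed (rule expand[symmetric])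
  have c: "frechet_derivative (\<lambda>w. ?D w (b u)) (at u) =
      (\<lambda>h. \<Sum>i\<in>Basis. (b u \<bullet> i) *\<^sub>R frechet_derivative (\<lambda>w. ?D w i) (at u) h)"
    using frechet_derivative_at[OF D[OF has_derivative_const[of "b u"]]] by simp
  have e: "(\<Sum>i\<in>Basis. (k h \<bullet> i) *\<^sub>R ?D u i) = ?D u (k h)" for k :: "'a \<Rightarrow> 'a" and h
    by (rule expand[OF S(2), symmetric])
  show ?thesis
    using D[OF b[unfolded frechet_derivative_works]] by (simp only: c sum.distrib e)
qed

section \<open>Calculus on an abstract surface\<close>

lemma mink_bounded_bilinear: "bounded_bilinear mink"
proof -
  have "bilinear mink"
    unfolding bilinear_def by (auto intro!: linearI simp: mink_def algebra_simps)
  then show ?thesis by (simp add: bilinear_conv_bounded_bilinear)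
qed

lemma mink_commute: "mink v w = mink w v"
  by (simp add: mink_def mult.commute)

lemmas mink_simps =
  bounded_bilinear.add_left[OF mink_bounded_bilinear]
  bounded_bilinear.add_right[OF mink_bounded_bilinear]
  bounded_bilinear.diff_left[OF mink_bounded_bilinear]
  bounded_bilinear.diff_right[OF mink_bounded_bilinear]
  bounded_bilinear.minus_left[OF mink_bounded_bilinear]
  bounded_bilinear.minus_right[OF mink_bounded_bilinear]
  bounded_bilinear.scaleR_left[OF mink_bounded_bilinear]
  bounded_bilinear.scaleR_right[OF mink_bounded_bilinear]
  bounded_bilinear.zero_left[OF mink_bounded_bilinear]
  bounded_bilinear.zero_right[OF mink_bounded_bilinear]

lemma mink_axis_4 [simp]: "mink v (axis 4 1) = v $ 4" "mink (axis 4 1) v = v $ 4"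
  by (simp_all add: mink_def axis_def)

lemma smooth_on_Ck: "smooth_on f S \<Longrightarrow> Ck_on k f S"
  by (simp add: smooth_on_def)

lemma smooth_on_differentiable: "smooth_on f S \<Longrightarrow> u \<in> S \<Longrightarrow> f differentiable (at u)"
  using smooth_on_Ck[of f S 1] by simp

lemma smooth_map_on_subset: "smooth_map_on M U F \<Longrightarrow> V \<subseteq> U \<Longrightarrow> smooth_map_on M V F"
  unfolding smooth_map_on_def smooth_on_def by (fastforce intro: Ck_on_subset)

abbreviation coord :: "(real^2) set \<times> (real^2 \<Rightarrow> 'a) \<Rightarrow> 'a \<Rightarrow> real^2" where
  "coord c p \<equiv> inv_into (fst c) (snd c) p"

abbreviation chart_domain :: "(real^2) set \<times> (real^2 \<Rightarrow> 'a) \<Rightarrow> 'a set \<Rightarrow> (real^2) set" where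
  "chart_domain c U \<equiv> {u \<in> fst c. snd c u \<in> U}"

lemma chart_diff_coord:
  "chart_diff c p F = frechet_derivative (F \<circ> snd c) (at (coord c p))"
  by (simp add: chart_diff_def split: prod.split)

text \<open>
  Differentiability is required in every chart at \<open>p\<close>, which makes the notion independent of charts
  by definition. Only the germ of \<open>F\<close> at \<open>p\<close> matters.
\<close>

definition mdiff :: "'a surface \<Rightarrow> 'a \<Rightarrow> ('a \<Rightarrow> 'b::real_normed_vector) \<Rightarrow> bool" where
  "mdiff M p F \<longleftrightarrow> (\<forall>c\<in>charts_at M p. (F \<circ> snd c) differentiable (at (coord c p)))"

lemma mdiffD:
  "mdiff M p F \<Longrightarrow> c \<in> charts_at M p \<Longrightarrow>
    (F \<circ> snd c has_derivative chart_diff c p F) (at (coord c p))"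
  by (simp add: mdiff_def chart_diff_coord frechet_derivative_works)

lemma chart_diff_eqI:
  "(F \<circ> snd c has_derivative D) (at (coord c p)) \<Longrightarrow> chart_diff c p F = D"
  by (simp add: chart_diff_coord frechet_derivative_at[symmetric])

locale rsurface =
  fixes M :: "'a surface"
  assumes riemannian: "riemannian_surface M"
begin

lemma atlas: "smooth_atlas M"
  using riemannian by (simp add: riemannian_surface_def)

lemma pos_smooth: "smooth_map_on M (points M) (pos M)"
  using riemannian by (simp add: riemannian_surface_def)

lemma pos_definite:
  "p \<in> points M \<Longrightarrow> c \<in> charts_at M p \<Longrightarrow> a \<noteq> 0 \<Longrightarrow>
    mink (chart_diff c p (pos M) a) (chart_diff c p (pos M) a) > 0"
  using riemannian by (auto simp: riemannian_surface_def)

lemma openin_points: "openin (surf_top M) (points M)"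
  by (simp add: points_def)

lemma open_subset_points: "openin (surf_top M) U \<Longrightarrow> U \<subseteq> points M"
  by (simp add: points_def openin_subset)

lemma charts_at_in_charts: "c \<in> charts_at M p \<Longrightarrow> c \<in> charts M"
  by (auto simp: charts_at_def)

lemma chart_exists:
  assumes "p \<in> points M"
  obtains c where "c \<in> charts_at M p"
proof -
  have "p \<in> (\<Union>(D, x)\<in>charts M. x ` D)"
    using atlas assms by (simp add: smooth_atlas_def)
  then show ?thesis using that by (auto simp: charts_at_def)
qed

lemma chart_facts:
  assumes "c \<in> charts M"
  shows "open (fst c)" "openin (surf_top M) (snd c ` fst c)" "inj_on (snd c) (fst c)"
    "homeomorphic_map (top_of_set (fst c)) (subtopology (surf_top M) (snd c ` fst c)) (snd c)"
proof -
  obtain D x where c: "c = (D, x)" by (cases c)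
  have *: "open D" "openin (surf_top M) (x ` D)"
    and h: "homeomorphic_map (top_of_set D) (subtopology (surf_top M) (x ` D)) x"
    using atlas assms unfolding c smooth_atlas_def by blast+
  then show "open (fst c)" "openin (surf_top M) (snd c ` fst c)"
    "homeomorphic_map (top_of_set (fst c)) (subtopology (surf_top M) (snd c ` fst c)) (snd c)"
    by (simp_all add: c)
  show "inj_on (snd c) (fst c)"
    using homeomorphic_imp_injective_map[OF h] by (simp add: c)
qed

lemma charts_at_iff: "u \<in> fst c \<Longrightarrow> c \<in> charts M \<Longrightarrow> c \<in> charts_at M (snd c u)"
  by (cases c) (auto simp: charts_at_def)

lemma coord_facts:
  assumes "c \<in> charts_at M p"
  shows "coord c p \<in> fst c" "snd c (coord c p) = p"
proof -
  have "p \<in> snd c ` fst c" using assms by (auto simp: charts_at_def)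
  then show "coord c p \<in> fst c" "snd c (coord c p) = p"
    by (auto simp: inv_into_into f_inv_into_f)
qed

lemma coord_chart: "c \<in> charts M \<Longrightarrow> u \<in> fst c \<Longrightarrow> coord c (snd c u) = u"
  using chart_facts(3) by (simp add: inv_into_f_f)

lemma open_chart_domain:
  assumes "c \<in> charts M" "openin (surf_top M) U"
  shows "open (chart_domain c U)"
proof -
  have "continuous_map (top_of_set (fst c)) (subtopology (surf_top M) (snd c ` fst c)) (snd c)"
    using chart_facts(4)[OF assms(1)] by (rule homeomorphic_imp_continuous_map)
  then have "continuous_map (top_of_set (fst c)) (surf_top M) (snd c)"
    by (simp add: continuous_map_in_subtopology)
  then have "openin (top_of_set (fst c)) {u \<in> topspace (top_of_set (fst c)). snd c u \<in> U}"
    using assms(2) by (rule openin_continuous_map_preimage)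
  then show ?thesis
    using chart_facts(1)[OF assms(1)] by (auto dest: openin_open_trans)
qed

lemma coord_in_chart_domain:
  "c \<in> charts_at M p \<Longrightarrow> p \<in> U \<Longrightarrow> coord c p \<in> chart_domain c U"
  using coord_facts[of c p] by simp

lemma smooth_map_on_chart:
  "smooth_map_on M U F \<Longrightarrow> c \<in> charts M \<Longrightarrow> smooth_on (F \<circ> snd c) (chart_domain c U)"
  unfolding smooth_map_on_def by (cases c) fastforce

lemma smooth_mdiff:
  assumes "smooth_map_on M U F" "p \<in> U"
  shows "mdiff M p F"
  unfolding mdiff_def
proof
  fix c assume c: "c \<in> charts_at M p"
  show "(F \<circ> snd c) differentiable (at (coord c p))"
    by (rule smooth_on_differentiable[OF smooth_map_on_chart[OF assms(1) charts_at_in_charts[OF c]]])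
      (rule coord_in_chart_domain[OF c assms(2)])
qed

text \<open>
  The map \<open>A\<close> is the derivative of the transition map and does not depend on \<open>F\<close>. The conclusion
  is stated for two value types because the same \<open>A\<close> has to serve the position vector and another map.
\<close>

lemma change_of_chart:
  assumes c: "c \<in> charts_at M p" and c': "c' \<in> charts_at M p"
  obtains A where
    "\<And>F :: 'a \<Rightarrow> 'b::real_normed_vector. mdiff M p F \<Longrightarrow> chart_diff c' p F = chart_diff c p F \<circ> A"
    "\<And>F :: 'a \<Rightarrow> 'c::real_normed_vector. mdiff M p F \<Longrightarrow> chart_diff c' p F = chart_diff c p F \<circ> A"
proof -
  define \<tau> where "\<tau> = inv_into (fst c) (snd c) \<circ> snd c'"
  define W where "W = chart_domain c' (snd c ` fst c)"
  have cs: "c \<in> charts M" "c' \<in> charts M" using assms charts_at_in_charts by auto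
  have W: "open W" unfolding W_def using open_chart_domain chart_facts cs by blast
  have p: "coord c' p \<in> W" using coord_facts[OF c'] coord_facts[OF c] unfolding W_def by (auto simp: image_iff intro!: bexI[of _ "coord c p"])
  have "smooth_on \<tau> W"
    using atlas cs unfolding smooth_atlas_def \<tau>_def W_def by (cases c; cases c') (simp, blast)
  then have \<tau>: "(\<tau> has_derivative frechet_derivative \<tau> (at (coord c' p))) (at (coord c' p))"
    using smooth_on_differentiable[OF _ p] frechet_derivative_works by blast
  have \<tau>p: "\<tau> (coord c' p) = coord c p"
    using coord_facts[OF c'] by (simp add: \<tau>_def)
  have "chart_diff c' p F = chart_diff c p F \<circ> frechet_derivative \<tau> (at (coord c' p))"
    if F: "mdiff M p F" for F :: "'a \<Rightarrow> 'd::real_normed_vector"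
  proof (rule chart_diff_eqI, rule has_derivative_transform_within_open[OF _ W p])
    show "((F \<circ> snd c) \<circ> \<tau> has_derivative chart_diff c p F \<circ> frechet_derivative \<tau> (at (coord c' p)))
       (at (coord c' p))"
      by (rule diff_chain_at[OF \<tau>]) (use mdiffD[OF F c] \<tau>p in simp)
    show "(F \<circ> snd c \<circ> \<tau>) w = (F \<circ> snd c') w" if "w \<in> W" for w
      using that by (simp add: \<tau>_def W_def f_inv_into_f)
  qed
  from that[OF this this] show ?thesis .
qed

lemma pos_mdiff: "p \<in> points M \<Longrightarrow> mdiff M p (pos M)"
  by (rule smooth_mdiff[OF pos_smooth])

lemma chart_diff_linear: "mdiff M p F \<Longrightarrow> c \<in> charts_at M p \<Longrightarrow> linear (chart_diff c p F)"
  by (rule has_derivative_linear[OF mdiffD])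

lemma chart_diff_pos_inject:
  assumes "p \<in> points M" "c \<in> charts_at M p" "chart_diff c p (pos M) a = chart_diff c p (pos M) b"
  shows "a = b"
proof (rule ccontr)
  assume "a \<noteq> b"
  then have "mink (chart_diff c p (pos M) (a - b)) (chart_diff c p (pos M) (a - b)) > 0"
    by (intro pos_definite assms) simp
  moreover have "chart_diff c p (pos M) (a - b) = 0"
    using linear_diff[OF chart_diff_linear[OF pos_mdiff[OF assms(1)] assms(2)], of a b] assms(3) by simp
  ultimately show False by (simp add: mink_simps)
qed

lemma tangent_space_chart:
  assumes p: "p \<in> points M" and c: "c \<in> charts_at M p"
  shows "tangent_space M p = range (chart_diff c p (pos M))"
proof -
  have "chart_diff c' p (pos M) a \<in> range (chart_diff c p (pos M))" if c': "c' \<in> charts_at M p" for c' a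
  proof -
    obtain A where "chart_diff c' p (pos M) = chart_diff c p (pos M) \<circ> A"
      by (rule change_of_chart[OF c c']) (use pos_mdiff[OF p] in blast)
    then show ?thesis by auto
  qed
  then show ?thesis unfolding tangent_space_def using c by blast
qed

text \<open>
  A second chart yields the same value: its vector is carried by the transition derivative \<open>A\<close> to a vector
  with the same image under the immersion, hence to \<open>a\<close> itself.
\<close>

lemma dir_deriv_chart:
  fixes F :: "'a \<Rightarrow> 'b::real_normed_vector"
  assumes p: "p \<in> points M" and c: "c \<in> charts_at M p" and F: "mdiff M p F"
  shows "dir_deriv M p (chart_diff c p (pos M) a) F = chart_diff c p F a"
  unfolding dir_deriv_def
proof (rule the_equality)
  show "\<exists>c'\<in>charts_at M p. \<exists>a'. chart_diff c p (pos M) a = chart_diff c' p (pos M) a' \<and>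
      chart_diff c p F a = chart_diff c' p F a'"
    using c by blast
next
  fix d
  assume "\<exists>c'\<in>charts_at M p. \<exists>a'. chart_diff c p (pos M) a = chart_diff c' p (pos M) a' \<and>
      d = chart_diff c' p F a'"
  then obtain c' a' where c': "c' \<in> charts_at M p"
    and a': "chart_diff c p (pos M) a = chart_diff c' p (pos M) a'" and d: "d = chart_diff c' p F a'"
    by blast
  obtain A where A: "chart_diff c' p (pos M) = chart_diff c p (pos M) \<circ> A"
    "chart_diff c' p F = chart_diff c p F \<circ> A"
    by (rule change_of_chart[OF c c']) (use pos_mdiff[OF p] F in blast)
  have "a = A a'" using a' A(1) chart_diff_pos_inject[OF p c] by simp
  then show "d = chart_diff c p F a" using A(2) d by simp
qed

lemma dir_deriv_linear:
  assumes p: "p \<in> points M" and F: "mdiff M p F" and v: "v \<in> tangent_space M p" and w: "w \<in> tangent_space M p"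
  shows "dir_deriv M p (v + w) F = dir_deriv M p v F + dir_deriv M p w F"
    "dir_deriv M p (r *\<^sub>R v) F = r *\<^sub>R dir_deriv M p v F"
    "dir_deriv M p (v - w) F = dir_deriv M p v F - dir_deriv M p w F"
proof -
  obtain c where c: "c \<in> charts_at M p" using chart_exists p by blast
  note L = dir_deriv_chart[OF p c F]
  note l = chart_diff_linear[OF pos_mdiff[OF p] c] and lF = chart_diff_linear[OF F c]
  obtain a b where ab: "v = chart_diff c p (pos M) a" "w = chart_diff c p (pos M) b"
    using v w unfolding tangent_space_chart[OF p c] by auto
  show "dir_deriv M p (v + w) F = dir_deriv M p v F + dir_deriv M p w F"
    using L[of "a + b"] L[of a] L[of b] linear_add[OF l] linear_add[OF lF] ab by metis
  show "dir_deriv M p (v - w) F = dir_deriv M p v F - dir_deriv M p w F"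
    using L[of "a - b"] L[of a] L[of b] linear_diff[OF l] linear_diff[OF lF] ab by metis
  show "dir_deriv M p (r *\<^sub>R v) F = r *\<^sub>R dir_deriv M p v F"
    using L[of "r *\<^sub>R a"] L[of a] linear_cmul[OF l] linear_cmul[OF lF] ab by metis
qed

lemma tangent_space_subspace: "p \<in> points M \<Longrightarrow> subspace (tangent_space M p)"
  by (rule chart_exists) (auto simp: tangent_space_chart intro!: linear_subspace_image chart_diff_linear pos_mdiff)

lemma tangent_space_pos_definite:
  assumes p: "p \<in> points M" and v: "v \<in> tangent_space M p" "v \<noteq> 0"
  shows "mink v v > 0"
proof -
  obtain c where c: "c \<in> charts_at M p" using chart_exists p by blast
  then obtain a where a: "v = chart_diff c p (pos M) a"
    using v tangent_space_chart[OF p c] by auto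
  then have "a \<noteq> 0" using v linear_0[OF chart_diff_linear[OF pos_mdiff[OF p] c]] by auto
  then show ?thesis using pos_definite[OF p c] a by simp
qed

lemma tangent_vectorE:
  assumes "p \<in> points M" "v \<in> tangent_space M p"
  obtains c a where "c \<in> charts_at M p" "v = chart_diff c p (pos M) a"
  using assms(2) by (auto simp: tangent_space_def)

text \<open>
  Transfers a differentiation rule for Frechet derivatives to the surface: it suffices to check the
  value \<open>d\<close> in each chart.
\<close>

lemma has_dir_derivI:
  assumes p: "p \<in> points M"
    and D: "\<And>c. c \<in> charts_at M p \<Longrightarrow> (F \<circ> snd c has_derivative D c) (at (coord c p))"
  shows "mdiff M p F"
    and "v \<in> tangent_space M p \<Longrightarrow>
      (\<And>c a. c \<in> charts_at M p \<Longrightarrow> v = chart_diff c p (pos M) a \<Longrightarrow> D c a = d) \<Longrightarrow>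
      dir_deriv M p v F = d"
proof -
  show *: "mdiff M p F" using D by (auto simp: mdiff_def differentiable_def)
  assume "v \<in> tangent_space M p"
    and d: "\<And>c a. c \<in> charts_at M p \<Longrightarrow> v = chart_diff c p (pos M) a \<Longrightarrow> D c a = d"
  then obtain c a where c: "c \<in> charts_at M p" "v = chart_diff c p (pos M) a"
    using tangent_vectorE[OF p] by metis
  then show "dir_deriv M p v F = d"
    using dir_deriv_chart[OF p c(1) *, of a] chart_diff_eqI[OF D[OF c(1)]] d[OF c] by simp
qed

lemma dir_deriv_cong:
  assumes U: "openin (surf_top M) U" "p \<in> U" and FG: "\<And>q. q \<in> U \<Longrightarrow> F q = G q"
    and F: "mdiff M p F"
  shows "mdiff M p G" "v \<in> tangent_space M p \<Longrightarrow> dir_deriv M p v G = dir_deriv M p v F"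
proof -
  have p: "p \<in> points M" using U open_subset_points by blast
  have D: "(G \<circ> snd c has_derivative chart_diff c p F) (at (coord c p))" if c: "c \<in> charts_at M p" for c
    by (rule has_derivative_transform_within_open[OF mdiffD[OF F c]
          open_chart_domain[OF charts_at_in_charts[OF c] U(1)] coord_in_chart_domain[OF c U(2)]])
      (simp add: FG)
  show "mdiff M p G" using has_dir_derivI(1)[OF p D] .
  show "dir_deriv M p v G = dir_deriv M p v F" if v: "v \<in> tangent_space M p"
    by (rule has_dir_derivI(2)[OF p D v]) (simp_all add: dir_deriv_chart[OF p _ F])
qed

lemma dir_deriv_const:
  assumes p: "p \<in> points M"
  shows "mdiff M p (\<lambda>q. k)" "v \<in> tangent_space M p \<Longrightarrow> dir_deriv M p v (\<lambda>q. k) = 0"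
proof -
  have D: "((\<lambda>q. k) \<circ> snd c has_derivative (\<lambda>a. 0)) (at (coord c p))" for c :: "(real^2) set \<times> (real^2 \<Rightarrow> 'a)"
    by (simp add: o_def)
  show "mdiff M p (\<lambda>q. k)" using has_dir_derivI(1)[OF p D] .
  show "dir_deriv M p v (\<lambda>q. k) = 0" if v: "v \<in> tangent_space M p"
    by (rule has_dir_derivI(2)[OF p D v]) simp_all
qed

lemma dir_deriv_add:
  assumes p: "p \<in> points M" and F: "mdiff M p F" and G: "mdiff M p G"
  shows "mdiff M p (\<lambda>q. F q + G q)"
    "v \<in> tangent_space M p \<Longrightarrow>
      dir_deriv M p v (\<lambda>q. F q + G q) = dir_deriv M p v F + dir_deriv M p v G"
proof -
  have D: "((\<lambda>q. F q + G q) \<circ> snd c has_derivative (\<lambda>a. chart_diff c p F a + chart_diff c p G a)) (at (coord c p))"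
    if c: "c \<in> charts_at M p" for c
    using has_derivative_add[OF mdiffD[OF F c] mdiffD[OF G c]] by (simp add: o_def)
  show "mdiff M p (\<lambda>q. F q + G q)" using has_dir_derivI(1)[OF p D] .
  show "dir_deriv M p v (\<lambda>q. F q + G q) = dir_deriv M p v F + dir_deriv M p v G"
    if v: "v \<in> tangent_space M p"
    by (rule has_dir_derivI(2)[OF p D v]) (simp_all add: dir_deriv_chart[OF p _ F] dir_deriv_chart[OF p _ G])
qed

lemma dir_deriv_bilinear:
  assumes B: "bounded_bilinear B" and p: "p \<in> points M" and F: "mdiff M p F" and G: "mdiff M p G"
  shows "mdiff M p (\<lambda>q. B (F q) (G q))"
    "v \<in> tangent_space M p \<Longrightarrow>
      dir_deriv M p v (\<lambda>q. B (F q) (G q)) = B (F p) (dir_deriv M p v G) + B (dir_deriv M p v F) (G p)"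
proof -
  have D: "((\<lambda>q. B (F q) (G q)) \<circ> snd c has_derivative
      (\<lambda>a. B (F p) (chart_diff c p G a) + B (chart_diff c p F a) (G p))) (at (coord c p))"
    if c: "c \<in> charts_at M p" for c
    using bounded_bilinear.FDERIV[OF B mdiffD[OF F c] mdiffD[OF G c]] coord_facts[OF c]
    by (simp add: o_def)
  show "mdiff M p (\<lambda>q. B (F q) (G q))" using has_dir_derivI(1)[OF p D] .
  show "dir_deriv M p v (\<lambda>q. B (F q) (G q)) = B (F p) (dir_deriv M p v G) + B (dir_deriv M p v F) (G p)"
    if v: "v \<in> tangent_space M p"
    by (rule has_dir_derivI(2)[OF p D v]) (simp_all add: dir_deriv_chart[OF p _ F] dir_deriv_chart[OF p _ G])
qed

lemmas dir_deriv_scaleR = dir_deriv_bilinear[OF bounded_bilinear_scaleR]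
lemmas dir_deriv_mult = dir_deriv_bilinear[OF bounded_bilinear_mult]
lemmas dir_deriv_mink = dir_deriv_bilinear[OF mink_bounded_bilinear]

lemma dir_deriv_bounded_linear:
  assumes L: "bounded_linear L" and p: "p \<in> points M" and F: "mdiff M p F"
  shows "mdiff M p (\<lambda>q. L (F q))"
    "v \<in> tangent_space M p \<Longrightarrow> dir_deriv M p v (\<lambda>q. L (F q)) = L (dir_deriv M p v F)"
proof -
  have D: "((\<lambda>q. L (F q)) \<circ> snd c has_derivative (\<lambda>a. L (chart_diff c p F a))) (at (coord c p))"
    if c: "c \<in> charts_at M p" for c
    using bounded_linear.has_derivative[OF L mdiffD[OF F c]] by (simp add: o_def)
  show "mdiff M p (\<lambda>q. L (F q))" using has_dir_derivI(1)[OF p D] .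
  show "dir_deriv M p v (\<lambda>q. L (F q)) = L (dir_deriv M p v F)" if v: "v \<in> tangent_space M p"
    by (rule has_dir_derivI(2)[OF p D v]) (simp_all add: dir_deriv_chart[OF p _ F])
qed

lemma dir_deriv_diff:
  assumes p: "p \<in> points M" and F: "mdiff M p F" and G: "mdiff M p G"
  shows "mdiff M p (\<lambda>q. F q - G q)"
    "v \<in> tangent_space M p \<Longrightarrow>
      dir_deriv M p v (\<lambda>q. F q - G q) = dir_deriv M p v F - dir_deriv M p v G"
proof -
  note m = dir_deriv_bounded_linear[OF bounded_linear_minus[OF bounded_linear_ident] p G]
  show "mdiff M p (\<lambda>q. F q - G q)" using dir_deriv_add(1)[OF p F m(1)] by simp
  show "dir_deriv M p v (\<lambda>q. F q - G q) = dir_deriv M p v F - dir_deriv M p v G"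
    if "v \<in> tangent_space M p"
    using dir_deriv_add(2)[OF p F m(1) that] m(2)[OF that] by simp
qed

lemma dir_deriv_pos:
  assumes p: "p \<in> points M" and v: "v \<in> tangent_space M p"
  shows "dir_deriv M p v (pos M) = v"
  using dir_deriv_chart[OF p _ pos_mdiff[OF p]] by (metis tangent_vectorE[OF p v])

lemma smooth_map_on_bounded_linear:
  assumes "openin (surf_top M) U" "bounded_linear L" "smooth_map_on M U F"
  shows "smooth_map_on M U (\<lambda>q. L (F q))"
  unfolding smooth_map_on_def smooth_on_def
proof (clarify)
  fix D x k assume c: "(D, x) \<in> charts M"
  show "Ck_on k ((\<lambda>q. L (F q)) \<circ> x) {u \<in> D. x u \<in> U}"
    using Ck_on_bounded_linear[OF open_chart_domain[OF c assms(1)] assms(2)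
        smooth_on_Ck[OF smooth_map_on_chart[OF assms(3) c]]] by (simp add: o_def)
qed

lemma smooth_map_on_add:
  assumes "openin (surf_top M) U" "smooth_map_on M U F" "smooth_map_on M U G"
  shows "smooth_map_on M U (\<lambda>q. F q + G q)"
  unfolding smooth_map_on_def smooth_on_def
proof (clarify)
  fix D x k assume c: "(D, x) \<in> charts M"
  show "Ck_on k ((\<lambda>q. F q + G q) \<circ> x) {u \<in> D. x u \<in> U}"
    using Ck_on_add[OF open_chart_domain[OF c assms(1)]
        smooth_on_Ck[OF smooth_map_on_chart[OF assms(2) c]]
        smooth_on_Ck[OF smooth_map_on_chart[OF assms(3) c]]] by (simp add: o_def)
qed

lemma smooth_map_on_bilinear:
  assumes "bounded_bilinear B" "openin (surf_top M) U" "smooth_map_on M U F" "smooth_map_on M U G"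
  shows "smooth_map_on M U (\<lambda>q. B (F q) (G q))"
  unfolding smooth_map_on_def smooth_on_def
proof (clarify)
  fix D x k assume c: "(D, x) \<in> charts M"
  show "Ck_on k ((\<lambda>q. B (F q) (G q)) \<circ> x) {u \<in> D. x u \<in> U}"
    using Ck_on_bilinear[OF open_chart_domain[OF c assms(2)] assms(1)
        smooth_on_Ck[OF smooth_map_on_chart[OF assms(3) c]]
        smooth_on_Ck[OF smooth_map_on_chart[OF assms(4) c]]] by (simp add: o_def)
qed

lemma smooth_map_on_const: "smooth_map_on M U (\<lambda>q. k)"
  by (auto simp: smooth_map_on_def smooth_on_def o_def Ck_on_const)

lemma smooth_map_on_cong:
  assumes "openin (surf_top M) U" "\<And>q. q \<in> U \<Longrightarrow> F q = G q" "smooth_map_on M U F"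
  shows "smooth_map_on M U G"
  unfolding smooth_map_on_def smooth_on_def
proof (clarify)
  fix D x k assume c: "(D, x) \<in> charts M"
  show "Ck_on k (G \<circ> x) {u \<in> D. x u \<in> U}"
    using Ck_on_cong[OF open_chart_domain[OF c assms(1)] _
        smooth_on_Ck[OF smooth_map_on_chart[OF assms(3) c]], of "G \<circ> x"] assms(2) by simp
qed

lemma tangent_field_subset: "tangent_field M U X \<Longrightarrow> V \<subseteq> U \<Longrightarrow> tangent_field M V X"
  by (auto simp: tangent_field_def intro: smooth_map_on_subset)

end

section \<open>Second derivatives, the Lie bracket and the tangential projection\<close>

lemma real2_expand: "(w :: real^2) = (w $ 1) *\<^sub>R axis 1 1 + (w $ 2) *\<^sub>R axis 2 1"
  by (simp add: vec_eq_iff forall_2 axis_def)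

lemma cramer2:
  fixes g11 g12 g22 :: real
  assumes "r1 = x1 * g11 + x2 * g12" "r2 = x1 * g12 + x2 * g22" "g11 * g22 - g12 * g12 \<noteq> 0"
  shows "(g22 * r1 - g12 * r2) / (g11 * g22 - g12 * g12) = x1"
    "(g11 * r2 - g12 * r1) / (g11 * g22 - g12 * g12) = x2"
proof -
  have "g22 * r1 - g12 * r2 = x1 * (g11 * g22 - g12 * g12)"
    "g11 * r2 - g12 * r1 = x2 * (g11 * g22 - g12 * g12)"
    unfolding assms(1,2) by algebra+
  then show "(g22 * r1 - g12 * r2) / (g11 * g22 - g12 * g12) = x1"
    "(g11 * r2 - g12 * r1) / (g11 * g22 - g12 * g12) = x2"
    using assms(3) by simp_all
qed

context rsurface
begin

text \<open>
  The components solve the linear system whose matrix is the Gram matrix of the coordinate vectors. It is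
  invertible because the induced metric is positive definite, and Cramer's rule shows that the solution is
  differentiable.
\<close>

lemma tangent_field_components:
  assumes U: "openin (surf_top M) U" and X: "tangent_field M U X" and c: "c \<in> charts M"
  obtains a :: "real^2 \<Rightarrow> real^2" where
    "\<And>u. u \<in> chart_domain c U \<Longrightarrow> X (snd c u) = chart_diff c (snd c u) (pos M) (a u)"
    "\<And>u. u \<in> chart_domain c U \<Longrightarrow> a differentiable (at u)"
proof -
  define \<phi> where "\<phi> = pos M \<circ> snd c"
  define b where "b = (\<lambda>(i::2) u. frechet_derivative \<phi> (at u) (axis i 1))"
  define g where "g = (\<lambda>i j u. mink (b i u) (b j u))"
  define r where "r = (\<lambda>i u. mink (X (snd c u)) (b i u))"
  define \<Delta> where "\<Delta> = (\<lambda>u. g 1 1 u * g 2 2 u - g 1 2 u * g 1 2 u)"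
  define a where "a = (\<lambda>u. ((g 2 2 u * r 1 u - g 1 2 u * r 2 u) / \<Delta> u) *\<^sub>R axis (1::2) (1::real) +
    ((g 1 1 u * r 2 u - g 1 2 u * r 1 u) / \<Delta> u) *\<^sub>R axis 2 1)"
  let ?W = "chart_domain c U"
  have "smooth_on \<phi> (chart_domain c (points M))"
    unfolding \<phi>_def by (rule smooth_map_on_chart[OF pos_smooth c])
  then have \<phi>: "Ck_on 2 \<phi> ?W"
    using open_subset_points[OF U] by (auto intro: Ck_on_subset smooth_on_Ck)
  have b: "b i differentiable (at u)" if "u \<in> ?W" for i u
    using \<phi> that by (simp add: b_def numeral_2_eq_2)
  have X': "(\<lambda>u. X (snd c u)) differentiable (at u)" if "u \<in> ?W" for u
    using smooth_on_differentiable[OF smooth_map_on_chart[OF X[unfolded tangent_field_def, THEN conjunct1] c] that]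
    by (simp add: o_def)
  have mink_diff: "(\<lambda>u. mink (F u) (G u)) differentiable (at u)"
    if "F differentiable (at u)" "G differentiable (at u)" for F G :: "real^2 \<Rightarrow> real^4" and u
    using bounded_bilinear.FDERIV[OF mink_bounded_bilinear that[unfolded frechet_derivative_works]]
    by (auto simp: differentiable_def)
  have *: "X (snd c u) = chart_diff c (snd c u) (pos M) (a u) \<and> \<Delta> u \<noteq> 0" if u: "u \<in> ?W" for u
  proof -
    let ?p = "snd c u"
    have p: "?p \<in> points M" using u open_subset_points[OF U] by auto
    have c': "c \<in> charts_at M ?p" using u c by (simp add: charts_at_iff)
    have J: "chart_diff c ?p (pos M) = frechet_derivative \<phi> (at u)"
      using u c by (simp add: chart_diff_coord \<phi>_def coord_chart)
    have l: "linear (frechet_derivative \<phi> (at u))"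
      using chart_diff_linear[OF pos_mdiff[OF p] c'] by (simp add: J)
    have Jw: "frechet_derivative \<phi> (at u) w = (w $ 1) *\<^sub>R b 1 u + (w $ 2) *\<^sub>R b 2 u" for w
      by (subst real2_expand[of w]) (simp add: linear_add[OF l] linear_cmul[OF l] b_def)
    have pd: "mink ((w $ 1) *\<^sub>R b 1 u + (w $ 2) *\<^sub>R b 2 u) ((w $ 1) *\<^sub>R b 1 u + (w $ 2) *\<^sub>R b 2 u) > 0"
      if "w \<noteq> 0" for w :: "real^2"
      using pos_definite[OF p c' that] by (simp add: J Jw)
    have sym: "g 2 1 u = g 1 2 u" by (simp add: g_def mink_commute)
    have gb: "mink (b i u) (b j u) = g i j u" for i j by (simp add: g_def)
    have g22: "g 2 2 u > 0"
      using pd[of "axis 2 1"] by (simp add: g_def axis_def vec_eq_iff)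
    have "0 < g 2 2 u * \<Delta> u"
    proof -
      \<comment> \<open>The vector orthogonal to the second coordinate vector; its squared length is \<open>g\<^sub>2\<^sub>2 \<Delta>\<close>.\<close>
      define w :: "real^2" where "w = g 2 2 u *\<^sub>R axis 1 1 + (- g 1 2 u) *\<^sub>R axis 2 1"
      have w: "w $ 1 = g 2 2 u" "w $ 2 = - g 1 2 u" by (simp_all add: w_def axis_def)
      then have "w \<noteq> 0" using g22 by auto
      from pd[OF this] show ?thesis
        by (simp add: w mink_simps gb sym \<Delta>_def algebra_simps)
    qed
    then have \<Delta>: "\<Delta> u \<noteq> 0" by auto
    have "X ?p \<in> tangent_space M ?p" using X u by (auto simp: tangent_field_def)
    then obtain w :: "real^2" where w: "X ?p = (w $ 1) *\<^sub>R b 1 u + (w $ 2) *\<^sub>R b 2 u"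
      using Jw unfolding tangent_space_chart[OF p c'] J by auto
    have "r 1 u = w $ 1 * g 1 1 u + w $ 2 * g 1 2 u" "r 2 u = w $ 1 * g 1 2 u + w $ 2 * g 2 2 u"
      using sym by (simp_all add: r_def w mink_simps g_def)
    from cramer2[OF this] \<Delta>
    have "a u = (w $ 1) *\<^sub>R axis 1 1 + (w $ 2) *\<^sub>R axis 2 1"
      by (simp add: a_def \<Delta>_def)
    then have "a u = w" by (simp add: real2_expand[symmetric])
    then show ?thesis using w \<Delta> Jw J by simp
  qed
  have "a differentiable (at u)" if u: "u \<in> ?W" for u
  proof -
    have gd: "g i j differentiable (at u)" for i j
      unfolding g_def by (intro mink_diff b u)
    have rd: "r i differentiable (at u)" for i
      unfolding r_def by (intro mink_diff b X' u)
    have \<Delta>d: "\<Delta> differentiable (at u)"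
      unfolding \<Delta>_def by (intro differentiable_diff differentiable_mult gd)
    show ?thesis unfolding a_def
      by (intro differentiable_add differentiable_scaleR differentiable_divide differentiable_diff
          differentiable_mult gd rd \<Delta>d differentiable_const) (use * u in auto)
  qed
  then show ?thesis using that * by blast
qed

text \<open>
  In a chart the derivative along \<open>X\<close> is \<open>w \<mapsto> f'(w) (a w)\<close>, so its derivative splits into a second
  derivative of \<open>f\<close>, symmetric in both directions, and a first derivative.
\<close>

lemma second_derivative_in_chart:
  assumes U: "openin (surf_top M) U" "p \<in> U" and c: "c \<in> charts_at M p"
    and a: "\<And>u. u \<in> chart_domain c U \<Longrightarrow> X (snd c u) = chart_diff c (snd c u) (pos M) (a u)"
      "a differentiable (at (coord c p))"
    and F: "smooth_map_on M U F"
  shows "((\<lambda>q. dir_deriv M q (X q) F) \<circ> snd c has_derivative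
    (\<lambda>h. frechet_derivative (\<lambda>w. frechet_derivative (F \<circ> snd c) (at w) (a (coord c p))) (at (coord c p)) h +
       chart_diff c p F (frechet_derivative a (at (coord c p)) h))) (at (coord c p))"
proof -
  let ?W = "chart_domain c U" and ?u = "coord c p"
  note cM = charts_at_in_charts[OF c]
  have W: "open ?W" "?u \<in> ?W" using open_chart_domain[OF cM U(1)] coord_in_chart_domain[OF c U(2)] by auto
  have "Ck_on 2 (F \<circ> snd c) ?W" by (rule smooth_on_Ck[OF smooth_map_on_chart[OF F cM]])
  from derivative_along_field[OF W this a(2)]
  have "((\<lambda>w. frechet_derivative (F \<circ> snd c) (at w) (a w)) has_derivative
    (\<lambda>h. frechet_derivative (\<lambda>w. frechet_derivative (F \<circ> snd c) (at w) (a ?u)) (at ?u) h +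
       chart_diff c p F (frechet_derivative a (at ?u) h))) (at ?u)"
    by (simp add: chart_diff_coord)
  then show ?thesis
  proof (rule has_derivative_transform_within_open[OF _ W])
    fix u assume u: "u \<in> ?W"
    have p: "snd c u \<in> points M" using u open_subset_points[OF U(1)] by auto
    have c': "c \<in> charts_at M (snd c u)" using u cM by (simp add: charts_at_iff)
    have m: "mdiff M (snd c u) F" using smooth_mdiff[OF F] u by simp
    show "frechet_derivative (F \<circ> snd c) (at u) (a u) = ((\<lambda>q. dir_deriv M q (X q) F) \<circ> snd c) u"
      using dir_deriv_chart[OF p c' m, of "a u"] a(1)[OF u] u
      by (simp add: chart_diff_coord coord_chart[OF cM])
  qed
qed

lemma mdiff_dir_deriv:
  assumes U: "openin (surf_top M) U" "p \<in> U" and X: "tangent_field M U X" and F: "smooth_map_on M U F"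
  shows "mdiff M p (\<lambda>q. dir_deriv M q (X q) F)"
  unfolding mdiff_def
proof
  fix c assume c: "c \<in> charts_at M p"
  obtain a where "\<And>u. u \<in> chart_domain c U \<Longrightarrow> X (snd c u) = chart_diff c (snd c u) (pos M) (a u)"
    "\<And>u. u \<in> chart_domain c U \<Longrightarrow> a differentiable (at u)"
    using tangent_field_components[OF U(1) X charts_at_in_charts[OF c]] by blast
  from second_derivative_in_chart[OF U c this(1) this(2)[OF coord_in_chart_domain[OF c U(2)]] F]
  show "((\<lambda>q. dir_deriv M q (X q) F) \<circ> snd c) differentiable (at (coord c p))"
    by (auto simp: differentiable_def)
qed

text \<open>
  In a chart the second derivatives of \<open>F\<close> cancel by symmetry, and what remains is the derivative of
  \<open>F\<close> along the vector with components \<open>z = b'(a) - a'(b)\<close>. Applying this to the position vector,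
  whose derivative along a tangent field is the field itself, identifies that vector with \<open>Z\<close>.
\<close>

lemma dir_deriv_commute:
  fixes F :: "'a \<Rightarrow> 'b::euclidean_space"
  assumes U: "openin (surf_top M) U" "p \<in> U" and X: "tangent_field M U X" and Y: "tangent_field M U Y"
  defines "Z \<equiv> dir_deriv M p (X p) Y - dir_deriv M p (Y p) X"
  shows "Z \<in> tangent_space M p"
    and "smooth_map_on M U F \<Longrightarrow>
      dir_deriv M p (X p) (\<lambda>q. dir_deriv M q (Y q) F) - dir_deriv M p (Y p) (\<lambda>q. dir_deriv M q (X q) F) =
      dir_deriv M p Z F"
proof -
  have p: "p \<in> points M" using U open_subset_points by auto
  obtain c where c: "c \<in> charts_at M p" using chart_exists[OF p] by blast
  note cM = charts_at_in_charts[OF c]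
  let ?u = "coord c p"
  have u: "?u \<in> chart_domain c U" by (rule coord_in_chart_domain[OF c U(2)])
  obtain a where a: "\<And>u. u \<in> chart_domain c U \<Longrightarrow> X (snd c u) = chart_diff c (snd c u) (pos M) (a u)"
    "\<And>u. u \<in> chart_domain c U \<Longrightarrow> a differentiable (at u)"
    using tangent_field_components[OF U(1) X cM] by blast
  obtain b where b: "\<And>u. u \<in> chart_domain c U \<Longrightarrow> Y (snd c u) = chart_diff c (snd c u) (pos M) (b u)"
    "\<And>u. u \<in> chart_domain c U \<Longrightarrow> b differentiable (at u)"
    using tangent_field_components[OF U(1) Y cM] by blast
  define z where "z = frechet_derivative b (at ?u) (a ?u) - frechet_derivative a (at ?u) (b ?u)"
  have XY: "X p = chart_diff c p (pos M) (a ?u)" "Y p = chart_diff c p (pos M) (b ?u)"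
    using a(1)[OF u] b(1)[OF u] coord_facts[OF c] by simp_all
  have comm: "dir_deriv M p (X p) (\<lambda>q. dir_deriv M q (Y q) F) - dir_deriv M p (Y p) (\<lambda>q. dir_deriv M q (X q) F) =
      chart_diff c p F z" if F: "smooth_map_on M U F" for F :: "'a \<Rightarrow> 'c::euclidean_space"
  proof -
    have C2: "Ck_on 2 (F \<circ> snd c) (chart_domain c U)"
      by (rule smooth_on_Ck[OF smooth_map_on_chart[OF F cM]])
    have l: "linear (chart_diff c p F)"
      by (rule chart_diff_linear[OF smooth_mdiff[OF F U(2)] c])
    have "dir_deriv M p (X p) (\<lambda>q. dir_deriv M q (Y q) F) =
       frechet_derivative (\<lambda>w. frechet_derivative (F \<circ> snd c) (at w) (b ?u)) (at ?u) (a ?u) +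
         chart_diff c p F (frechet_derivative b (at ?u) (a ?u))"
      using dir_deriv_chart[OF p c mdiff_dir_deriv[OF U Y F], of "a ?u"]
        fun_cong[OF chart_diff_eqI[OF second_derivative_in_chart[where X = Y, OF U c b(1) b(2)[OF u] F]], of "a ?u"]
      by (simp only: XY)
    moreover have "dir_deriv M p (Y p) (\<lambda>q. dir_deriv M q (X q) F) =
       frechet_derivative (\<lambda>w. frechet_derivative (F \<circ> snd c) (at w) (a ?u)) (at ?u) (b ?u) +
         chart_diff c p F (frechet_derivative a (at ?u) (b ?u))"
      using dir_deriv_chart[OF p c mdiff_dir_deriv[OF U X F], of "b ?u"]
        fun_cong[OF chart_diff_eqI[OF second_derivative_in_chart[where X = X, OF U c a(1) a(2)[OF u] F]], of "b ?u"]
      by (simp only: XY)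
    moreover note mixed_derivatives_commute[OF open_chart_domain[OF cM U(1)] u C2, of "a ?u" "b ?u"]
    ultimately show ?thesis by (simp add: z_def linear_diff[OF l])
  qed
  have XT: "X p \<in> tangent_space M p" "Y p \<in> tangent_space M p"
    using X Y U(2) by (auto simp: tangent_field_def)
  have pU: "smooth_map_on M U (pos M)"
    by (rule smooth_map_on_subset[OF pos_smooth open_subset_points[OF U(1)]])
  have mXY: "mdiff M p X" "mdiff M p Y"
    using X Y U(2) by (auto simp: tangent_field_def intro: smooth_mdiff)
  have pX: "X q = dir_deriv M q (X q) (pos M)" and pY: "Y q = dir_deriv M q (Y q) (pos M)" if "q \<in> U" for q
    using dir_deriv_pos X Y that open_subset_points[OF U(1)] by (auto simp: tangent_field_def)
  have Z: "Z = chart_diff c p (pos M) z"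
    unfolding Z_def comm[OF pU, symmetric]
    using dir_deriv_cong(2)[OF U pX mXY(1) XT(2)] dir_deriv_cong(2)[OF U pY mXY(2) XT(1)] by simp
  then show "Z \<in> tangent_space M p" unfolding tangent_space_chart[OF p c] by simp
  show "dir_deriv M p (X p) (\<lambda>q. dir_deriv M q (Y q) F) - dir_deriv M p (Y p) (\<lambda>q. dir_deriv M q (X q) F) =
      dir_deriv M p Z F" if F: "smooth_map_on M U F"
    using comm[OF F] Z dir_deriv_chart[OF p c smooth_mdiff[OF F U(2)], of z] by simp
qed

text \<open>
  The coordinates of the position vector are smooth functions whose derivatives along \<open>v\<close> are the
  coordinates of \<open>v\<close>, so a derivation determines its vector.
\<close>

lemma lie_bracket_eq:
  assumes U: "openin (surf_top M) U" "p \<in> U" and X: "tangent_field M U X" and Y: "tangent_field M U Y"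
  shows "lie_bracket M X Y p = dir_deriv M p (X p) Y - dir_deriv M p (Y p) X"
  unfolding lie_bracket_def
proof (rule the_equality, intro conjI allI impI)
  show "dir_deriv M p (X p) Y - dir_deriv M p (Y p) X \<in> tangent_space M p"
    by (rule dir_deriv_commute(1)[OF U X Y])
next
  fix V :: "'a set" and f :: "'a \<Rightarrow> real"
  assume V: "openin (surf_top M) V \<and> p \<in> V \<and> smooth_map_on M V f"
  have "openin (surf_top M) (U \<inter> V)" "p \<in> U \<inter> V" "tangent_field M (U \<inter> V) X"
    "tangent_field M (U \<inter> V) Y" "smooth_map_on M (U \<inter> V) f"
    using U V by (auto intro: tangent_field_subset[OF X] tangent_field_subset[OF Y] smooth_map_on_subset)
  from dir_deriv_commute(2)[OF this]
  show "dir_deriv M p (dir_deriv M p (X p) Y - dir_deriv M p (Y p) X) f =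
      dir_deriv M p (X p) (\<lambda>q. dir_deriv M q (Y q) f) - dir_deriv M p (Y p) (\<lambda>q. dir_deriv M q (X q) f)" ..
next
  fix v
  assume v: "v \<in> tangent_space M p \<and> (\<forall>V (f :: 'a \<Rightarrow> real). openin (surf_top M) V \<and> p \<in> V \<and> smooth_map_on M V f \<longrightarrow>
    dir_deriv M p v f =
      dir_deriv M p (X p) (\<lambda>q. dir_deriv M q (Y q) f) - dir_deriv M p (Y p) (\<lambda>q. dir_deriv M q (X q) f))"
  let ?Z = "dir_deriv M p (X p) Y - dir_deriv M p (Y p) X"
  have p: "p \<in> points M" using U open_subset_points by auto
  show "v = ?Z"
  proof (rule vec_eq_iff[THEN iffD2], rule allI)
    fix i
    let ?f = "\<lambda>q. pos M q $ i"
    have f: "smooth_map_on M U ?f"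
      by (rule smooth_map_on_bounded_linear[OF U(1) bounded_linear_vec_nth
            smooth_map_on_subset[OF pos_smooth open_subset_points[OF U(1)]]])
    have D: "dir_deriv M p w ?f = w $ i" if "w \<in> tangent_space M p" for w
      using dir_deriv_bounded_linear(2)[OF bounded_linear_vec_nth p pos_mdiff[OF p] that]
        dir_deriv_pos[OF p that] by simp
    have "dir_deriv M p v ?f = dir_deriv M p ?Z ?f"
      using v U f dir_deriv_commute(2)[OF U X Y f] by simp
    then show "v $ i = ?Z $ i" using D v dir_deriv_commute(1)[OF U X Y] by simp
  qed
qed

lemma tan_partI:
  assumes p: "p \<in> points M" and t: "t \<in> tangent_space M p" "\<And>v. v \<in> tangent_space M p \<Longrightarrow> mink (w - t) v = 0"
  shows "tan_part M p w = t"
  unfolding tan_part_def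
proof (rule the_equality)
  fix s assume s: "s \<in> tangent_space M p \<and> (\<forall>v\<in>tangent_space M p. mink (w - s) v = 0)"
  have d: "s - t \<in> tangent_space M p"
    using s t subspace_diff[OF tangent_space_subspace[OF p]] by blast
  then have "mink (w - t) (s - t) = 0" "mink (w - s) (s - t) = 0" using s t by auto
  then have "mink (s - t) (s - t) = 0" by (simp add: mink_simps)
  then show "s = t" using tangent_space_pos_definite[OF p d] by force
qed (use t in auto)

text \<open>
  The ambient metric is indefinite but positive definite on the tangent plane, so Gram-Schmidt on
  the two coordinate vectors yields the orthogonal projection.
\<close>

lemma tan_part_props:
  assumes p: "p \<in> points M"
  shows "tan_part M p w \<in> tangent_space M p"
    and "v \<in> tangent_space M p \<Longrightarrow> mink (w - tan_part M p w) v = 0"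
proof -
  obtain c where c: "c \<in> charts_at M p" using chart_exists[OF p] by blast
  let ?T = "tangent_space M p" and ?J = "chart_diff c p (pos M)"
  have l: "linear ?J" by (rule chart_diff_linear[OF pos_mdiff[OF p] c])
  have T: "?T = range ?J" by (rule tangent_space_chart[OF p c])
  have sub: "subspace ?T" by (rule tangent_space_subspace[OF p])
  define b where "b = ?J (axis 1 1)"
  define k where "k = mink (?J (axis 2 1)) b / mink b b"
  define d where "d = ?J (axis 2 1) - k *\<^sub>R b"
  have d: "d = ?J (axis 2 1 - k *\<^sub>R axis 1 1)"
    by (simp add: d_def b_def linear_diff[OF l] linear_cmul[OF l])
  have bb: "mink b b > 0" unfolding b_def by (rule pos_definite[OF p c]) (simp add: axis_eq_0_iff)
  have dd: "mink d d > 0" unfolding d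
    by (rule pos_definite[OF p c]) (simp add: vec_eq_iff forall_2 axis_def)
  have bd: "mink d b = 0" using bb by (simp add: d_def mink_simps k_def)
  define t where "t = (mink w b / mink b b) *\<^sub>R b + (mink w d / mink d d) *\<^sub>R d"
  have bT: "b \<in> ?T" "d \<in> ?T" unfolding T d by (auto simp: b_def)
  have t: "t \<in> ?T" unfolding t_def by (intro subspace_add subspace_scale sub bT)
  have o: "mink (w - t) b = 0" "mink (w - t) d = 0"
    using bb dd bd mink_commute[of b d] by (simp_all add: t_def mink_simps)
  have perp: "mink (w - t) v = 0" if v: "v \<in> ?T" for v
  proof -
    obtain x where "v = ?J x" using v T by auto
    moreover have "?J x = (x $ 1) *\<^sub>R b + (x $ 2) *\<^sub>R (d + k *\<^sub>R b)"
      by (subst real2_expand[of x]) (simp only: linear_add[OF l] linear_cmul[OF l] b_def d_def diff_add_cancel)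
    ultimately have "v = (x $ 1) *\<^sub>R b + (x $ 2) *\<^sub>R (d + k *\<^sub>R b)" by simp
    then show ?thesis using o by (simp add: mink_simps)
  qed
  have "tan_part M p w = t" by (rule tan_partI[OF p t perp])
  then show "tan_part M p w \<in> ?T" "v \<in> ?T \<Longrightarrow> mink (w - tan_part M p w) v = 0"
    using t perp by auto
qed

end

section \<open>The moving frame of a surface on the light cone cylinder\<close>

text \<open>
  The Gram matrix of \<open>a\<close>, \<open>b\<close>, \<open>n\<close>, \<open>m\<close> is invertible, so the map \<open>\<Phi>\<close> that takes a vector to its
  four products is onto, hence injective, and the difference of the two sides lies in its kernel.
\<close>

lemma null_frame_expansion:
  assumes "mink a a = 1" "mink b b = 1" "mink a b = 0" "mink n n = 0" "mink m m = 0" "mink m n = -1"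
    "mink n a = 0" "mink n b = 0" "mink m a = 0" "mink m b = 0"
  shows "w = mink w a *\<^sub>R a + mink w b *\<^sub>R b - mink w m *\<^sub>R n - mink w n *\<^sub>R m"
proof -
  define \<Phi> :: "real^4 \<Rightarrow> real^4" where
    "\<Phi> = (\<lambda>z. mink z a *\<^sub>R axis 1 1 + mink z b *\<^sub>R axis 2 1 + mink z n *\<^sub>R axis 3 1 + mink z m *\<^sub>R axis 4 1)"
  have comm: "mink b a = 0" "mink n m = -1" "mink a n = 0" "mink b n = 0" "mink a m = 0" "mink b m = 0"
    using assms by (simp_all add: mink_commute)
  have l: "linear \<Phi>"
    unfolding \<Phi>_def by (rule linearI) (simp_all add: mink_simps algebra_simps)
  have comp: "\<Phi> z $ 1 = mink z a" "\<Phi> z $ 2 = mink z b" "\<Phi> z $ 3 = mink z n" "\<Phi> z $ 4 = mink z m" for z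
    by (simp_all add: \<Phi>_def axis_def)
  have "y = \<Phi> (y $ 1 *\<^sub>R a + y $ 2 *\<^sub>R b - y $ 3 *\<^sub>R m - y $ 4 *\<^sub>R n)" for y
    by (simp add: vec_eq_iff forall_4 comp mink_simps assms comm)
  then have "surj \<Phi>" unfolding surj_def by blast
  then have inj: "inj \<Phi>" using l linear_surjective_imp_injective by blast
  define z where "z = w - (mink w a *\<^sub>R a + mink w b *\<^sub>R b - mink w m *\<^sub>R n - mink w n *\<^sub>R m)"
  have "\<Phi> z = 0"
    by (simp add: vec_eq_iff forall_4 comp z_def mink_simps assms comm)
  then have "z = 0" using inj l by (simp add: linear_injective_0)
  then show ?thesis by (simp add: z_def)
qed

context rsurface
begin

lemma mink_const_deriv:
  assumes U: "openin (surf_top M) U" "p \<in> U" and F: "mdiff M p F" and G: "mdiff M p G"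
    and k: "\<And>q. q \<in> U \<Longrightarrow> mink (F q) (G q) = k" and v: "v \<in> tangent_space M p"
  shows "mink (dir_deriv M p v F) (G p) = - mink (F p) (dir_deriv M p v G)"
proof -
  have p: "p \<in> points M" using U open_subset_points by auto
  have "dir_deriv M p v (\<lambda>q. mink (F q) (G q)) = dir_deriv M p v (\<lambda>q. k)"
    by (rule dir_deriv_cong(2)[OF U _ dir_deriv_const(1)[OF p] v]) (simp add: k)
  then show ?thesis
    using dir_deriv_mink(2)[OF p F G v] dir_deriv_const(2)[OF p v, of k] by simp
qed

lemma mink_tan_part:
  assumes "p \<in> points M" "v \<in> tangent_space M p"
  shows "mink (tan_part M p w) v = mink w v"
  using tan_part_props(2)[OF assms, of w] by (simp add: mink_simps)

lemma mink_nor_part: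
  assumes "p \<in> points M" "v \<in> tangent_space M p"
  shows "mink (nor_part M p w) v = 0"
  using tan_part_props(2)[OF assms, of w] by (simp add: nor_part_def)

lemma tangent_fieldD:
  assumes "tangent_field M U X" "p \<in> U"
  shows "X p \<in> tangent_space M p" "mdiff M p X"
  using assms smooth_mdiff[of U X p] by (auto simp: tangent_field_def)

lemma normal_fieldD:
  assumes "normal_field M U \<zeta>" "p \<in> U"
  shows "v \<in> tangent_space M p \<Longrightarrow> mink (\<zeta> p) v = 0" "mdiff M p \<zeta>"
  using assms smooth_mdiff[of U \<zeta> p] by (auto simp: normal_field_def)

end

locale cone_surface = rsurface M for M :: "'a surface" +
  fixes e1 e2 \<xi> :: "'a \<Rightarrow> real^4" and \<alpha> \<beta> :: "'a \<Rightarrow> real"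
  assumes on_cone: "pos M ` points M \<subseteq> LC2_times_R"
    and xi_normal: "normal_field M (points M) \<xi>"
    and xi_null: "p \<in> points M \<Longrightarrow> mink (\<xi> p) (\<xi> p) = 0"
    and xi_theta: "p \<in> points M \<Longrightarrow> mink (\<xi> p) (theta_field M p) = -1"
    and e1_def: "p \<in> points M \<Longrightarrow> e1 p = tan_part M p (axis 4 1)"
    and e2_tangent: "tangent_field M (points M) e2"
    and e2_unit: "p \<in> points M \<Longrightarrow> mink (e2 p) (e2 p) = 1"
    and e1_e2: "p \<in> points M \<Longrightarrow> mink (e1 p) (e2 p) = 0"
    and alpha_smooth: "smooth_map_on M (points M) \<alpha>"
    and alpha_eq: "p \<in> points M \<Longrightarrow> normal_conn M e1 (theta_field M) p = \<alpha> p *\<^sub>R theta_field M p"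
    and beta_eq: "p \<in> points M \<Longrightarrow> \<beta> p = mink (shape_op M \<xi> p (e2 p)) (e2 p)"
    and alpha_nonzero: "p \<in> points M \<Longrightarrow> \<alpha> p \<noteq> 0"
begin

abbreviation \<theta> :: "'a \<Rightarrow> real^4" where "\<theta> \<equiv> theta_field M"

lemma theta_bounded_linear: "bounded_linear (\<lambda>w :: real^4. w - (w $ 4) *\<^sub>R axis 4 1)"
  by (rule linear_conv_bounded_linear[THEN iffD1], rule linearI) (simp_all add: algebra_simps)

lemma theta_pos: "\<theta> = (\<lambda>q. pos M q - (pos M q $ 4) *\<^sub>R axis 4 1)"
  by (simp add: fun_eq_iff theta_field_def vec_eq_iff axis_def)

lemma theta_smooth: "smooth_map_on M (points M) \<theta>"
  unfolding theta_pos
  by (rule smooth_map_on_bounded_linear[OF openin_points theta_bounded_linear pos_smooth])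

lemma theta_mdiff: "p \<in> points M \<Longrightarrow> mdiff M p \<theta>"
  by (rule smooth_mdiff[OF theta_smooth])

lemma theta_deriv_ambient:
  assumes p: "p \<in> points M" and v: "v \<in> tangent_space M p"
  shows "dir_deriv M p v \<theta> = v - (v $ 4) *\<^sub>R axis 4 1"
  unfolding theta_pos
  using dir_deriv_bounded_linear(2)[OF theta_bounded_linear p pos_mdiff[OF p] v] dir_deriv_pos[OF p v]
  by simp

lemma theta_null:
  assumes p: "p \<in> points M"
  shows "mink (\<theta> p) (\<theta> p) = 0" "\<theta> p \<noteq> 0"
proof -
  have "pos M p \<in> LC2_times_R" using on_cone p by auto
  then have "- ((pos M p $ 1)^2) + (pos M p $ 2)^2 + (pos M p $ 3)^2 = 0" "pos M p $ 1 > 0"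
    by (auto simp: LC2_times_R_def)
  then show "mink (\<theta> p) (\<theta> p) = 0" "\<theta> p \<noteq> 0"
    by (auto simp: mink_def theta_field_def vec_eq_iff power2_eq_square intro!: exI[of _ 1])
qed

text \<open>
  Differentiating \<open>\<langle>\<theta>, \<theta>\<rangle> = 0\<close> along \<open>v\<close> gives \<open>\<langle>\<theta>, v - v\<^sub>4 \<partial>\<^sub>4\<rangle> = 0\<close>, and \<open>\<theta>\<close> has no component along
  \<open>\<partial>\<^sub>4\<close>.
\<close>

lemma theta_perp:
  assumes p: "p \<in> points M" and v: "v \<in> tangent_space M p"
  shows "mink (\<theta> p) v = 0"
proof -
  have "mink (dir_deriv M p v \<theta>) (\<theta> p) = - mink (\<theta> p) (dir_deriv M p v \<theta>)"
    by (rule mink_const_deriv[OF openin_points p theta_mdiff[OF p] theta_mdiff[OF p] theta_null(1) v])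
  then have "mink (\<theta> p) (dir_deriv M p v \<theta>) = 0"
    by (simp add: mink_commute)
  moreover have "\<theta> p $ 4 = 0" by (simp add: theta_field_def)
  ultimately show ?thesis by (simp add: theta_deriv_ambient[OF p v] mink_simps)
qed

lemma theta_normal: "normal_field M (points M) \<theta>"
  by (simp add: normal_field_def theta_smooth theta_perp)

lemma e1_T: "p \<in> points M \<Longrightarrow> e1 p \<in> tangent_space M p"
  by (simp add: e1_def tan_part_props)

lemma e2_T: "p \<in> points M \<Longrightarrow> e2 p \<in> tangent_space M p"
  using e2_tangent by (simp add: tangent_field_def)

lemma mink_e1: "p \<in> points M \<Longrightarrow> v \<in> tangent_space M p \<Longrightarrow> v $ 4 = mink v (e1 p)"
  using mink_tan_part[of p v "axis 4 1"] by (simp add: e1_def mink_commute)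

text \<open>
  The equation that defines \<open>\<alpha>\<close> says that \<open>m (e1 - \<partial>\<^sub>4) = \<alpha> \<theta>\<close> with \<open>m = \<langle>e1, e1\<rangle>\<close>. As \<open>\<alpha> \<noteq> 0\<close>,
  also \<open>m \<noteq> 0\<close>; hence \<open>e1 - \<partial>\<^sub>4\<close> is light-like, and comparing squared lengths gives \<open>m = 1\<close>.
\<close>

lemma e1_unit_and_axis:
  assumes p: "p \<in> points M"
  shows "mink (e1 p) (e1 p) = 1" "e1 p = axis 4 1 + \<alpha> p *\<^sub>R \<theta> p"
proof -
  define m where "m = mink (e1 p) (e1 p)"
  have m4: "e1 p $ 4 = m" using mink_e1[OF p e1_T[OF p]] by (simp add: m_def)
  have tp: "tan_part M p (e1 p - m *\<^sub>R axis 4 1) = e1 p - m *\<^sub>R e1 p"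
  proof (rule tan_partI[OF p])
    show "e1 p - m *\<^sub>R e1 p \<in> tangent_space M p"
      by (intro subspace_diff subspace_scale tangent_space_subspace p e1_T)
    show "mink (e1 p - m *\<^sub>R axis 4 1 - (e1 p - m *\<^sub>R e1 p)) v = 0" if "v \<in> tangent_space M p" for v
      using mink_e1[OF p that] by (simp add: mink_simps mink_commute)
  qed
  have N: "m *\<^sub>R (e1 p - axis 4 1) = \<alpha> p *\<^sub>R \<theta> p"
    using alpha_eq[OF p]
    unfolding normal_conn_def nor_part_def theta_deriv_ambient[OF p e1_T[OF p]] m4 tp
    by (simp add: algebra_simps)
  have m0: "m \<noteq> 0" using N alpha_nonzero[OF p] theta_null(2)[OF p] by auto
  have "mink (m *\<^sub>R (e1 p - axis 4 1)) (m *\<^sub>R (e1 p - axis 4 1)) = 0"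
    unfolding N by (simp add: mink_simps theta_null(1)[OF p])
  then have "mink (e1 p - axis 4 1) (e1 p - axis 4 1) = 0"
    using m0 by (simp add: mink_simps)
  then have m1: "m = 1"
    using m4 by (simp add: mink_simps m_def[symmetric])
  then show "mink (e1 p) (e1 p) = 1" by (simp add: m_def)
  show "e1 p = axis 4 1 + \<alpha> p *\<^sub>R \<theta> p" using N m1 by (simp add: algebra_simps)
qed

lemma e1_tangent: "tangent_field M (points M) e1"
proof -
  have "smooth_map_on M (points M) (\<lambda>q. axis 4 1 + \<alpha> q *\<^sub>R \<theta> q)"
    by (rule smooth_map_on_add[OF openin_points smooth_map_on_const
          smooth_map_on_bilinear[OF bounded_bilinear_scaleR openin_points alpha_smooth theta_smooth]])
  from smooth_map_on_cong[OF openin_points e1_unit_and_axis(2)[symmetric] this]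
  have "smooth_map_on M (points M) e1" .
  then show ?thesis by (simp add: tangent_field_def e1_T)
qed

lemma frame: "orthonormal_frame M (points M) e1 e2"
  by (simp add: orthonormal_frame_def e1_tangent e2_tangent e1_unit_and_axis(1) e2_unit e1_e2)

lemma mdiffs:
  assumes "p \<in> points M"
  shows "mdiff M p e1" "mdiff M p e2" "mdiff M p \<xi>" "mdiff M p \<alpha>"
  using tangent_fieldD(2)[OF e1_tangent assms] tangent_fieldD(2)[OF e2_tangent assms]
    normal_fieldD(2)[OF xi_normal assms] smooth_mdiff[OF alpha_smooth assms] by auto

lemma xi_perp: "p \<in> points M \<Longrightarrow> v \<in> tangent_space M p \<Longrightarrow> mink (\<xi> p) v = 0"
  by (rule normal_fieldD(1)[OF xi_normal])

lemma frame_products: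
  assumes p: "p \<in> points M"
  shows "mink (e1 p) (e1 p) = 1" "mink (e2 p) (e2 p) = 1" "mink (e1 p) (e2 p) = 0" "mink (e2 p) (e1 p) = 0"
    "mink (\<theta> p) (\<theta> p) = 0" "mink (\<xi> p) (\<xi> p) = 0" "mink (\<xi> p) (\<theta> p) = -1" "mink (\<theta> p) (\<xi> p) = -1"
    "mink (\<theta> p) (e1 p) = 0" "mink (\<theta> p) (e2 p) = 0" "mink (\<xi> p) (e1 p) = 0" "mink (\<xi> p) (e2 p) = 0"
    "mink (e1 p) (\<theta> p) = 0" "mink (e2 p) (\<theta> p) = 0" "mink (e1 p) (\<xi> p) = 0" "mink (e2 p) (\<xi> p) = 0"
  using e1_unit_and_axis(1) e2_unit e1_e2 theta_null(1) xi_null xi_theta theta_perp xi_perp e1_T e2_T p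
  by (simp_all add: mink_commute[of "e2 p" "e1 p"] mink_commute[of "\<theta> p" "\<xi> p"]
      mink_commute[of "e1 p" "\<theta> p"] mink_commute[of "e2 p" "\<theta> p"]
      mink_commute[of "e1 p" "\<xi> p"] mink_commute[of "e2 p" "\<xi> p"])

lemma frame_expansion:
  assumes p: "p \<in> points M"
  shows "w = mink w (e1 p) *\<^sub>R e1 p + mink w (e2 p) *\<^sub>R e2 p - mink w (\<xi> p) *\<^sub>R \<theta> p - mink w (\<theta> p) *\<^sub>R \<xi> p"
  by (rule null_frame_expansion) (simp_all add: frame_products[OF p])

lemma tangent_expansion:
  assumes p: "p \<in> points M" and v: "v \<in> tangent_space M p"
  shows "v = mink v (e1 p) *\<^sub>R e1 p + mink v (e2 p) *\<^sub>R e2 p"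
  using frame_expansion[OF p, of v] xi_perp[OF p v] theta_perp[OF p v]
  by (simp add: mink_commute[of v "\<xi> p"] mink_commute[of v "\<theta> p"])

lemma tan_part_frame:
  assumes p: "p \<in> points M"
  shows "tan_part M p w = mink w (e1 p) *\<^sub>R e1 p + mink w (e2 p) *\<^sub>R e2 p"
  using tangent_expansion[OF p tan_part_props(1)[OF p, of w]]
  by (simp add: mink_tan_part[OF p e1_T[OF p]] mink_tan_part[OF p e2_T[OF p]])

lemma nor_part_frame:
  assumes p: "p \<in> points M"
  shows "nor_part M p w = - mink w (\<xi> p) *\<^sub>R \<theta> p - mink w (\<theta> p) *\<^sub>R \<xi> p"
  using frame_expansion[OF p, of w] unfolding nor_part_def tan_part_frame[OF p]
  by (simp add: algebra_simps)

text \<open>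
  By the structure equations below, \<open>\<epsilon>\<close> and \<open>\<gamma>\<close> are the coefficients of \<open>\<theta>\<close> in
  \<open>h(e1, e1)\<close> and \<open>h(e1, e2)\<close>.
\<close>

definition \<epsilon> :: "'a \<Rightarrow> real" where "\<epsilon> p = dir_deriv M p (e1 p) \<alpha> + (\<alpha> p)^2"

definition \<gamma> :: "'a \<Rightarrow> real" where "\<gamma> p = dir_deriv M p (e2 p) \<alpha>"

lemma alpha_deriv:
  assumes p: "p \<in> points M" and v: "v \<in> tangent_space M p"
  shows "dir_deriv M p v \<alpha> = mink v (e1 p) * (\<epsilon> p - (\<alpha> p)^2) + mink v (e2 p) * \<gamma> p"
proof -
  note T = e1_T[OF p] e2_T[OF p] and m = mdiffs(4)[OF p]
  have s: "r *\<^sub>R e1 p \<in> tangent_space M p" "r *\<^sub>R e2 p \<in> tangent_space M p" for r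
    by (intro subspace_scale tangent_space_subspace p T)+
  have "dir_deriv M p v \<alpha> = dir_deriv M p (mink v (e1 p) *\<^sub>R e1 p + mink v (e2 p) *\<^sub>R e2 p) \<alpha>"
    using tangent_expansion[OF p v] by simp
  also have "\<dots> = mink v (e1 p) * dir_deriv M p (e1 p) \<alpha> + mink v (e2 p) * dir_deriv M p (e2 p) \<alpha>"
    using dir_deriv_linear(1)[OF p m s(1) s(2)] dir_deriv_linear(2)[OF p m T(1) T(1)]
      dir_deriv_linear(2)[OF p m T(2) T(2)] by simp
  finally show ?thesis by (simp add: \<epsilon>_def \<gamma>_def)
qed

lemma theta_deriv:
  assumes p: "p \<in> points M" and v: "v \<in> tangent_space M p"
  shows "dir_deriv M p v \<theta> = mink v (e2 p) *\<^sub>R e2 p + (\<alpha> p * mink v (e1 p)) *\<^sub>R \<theta> p"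
proof -
  have a: "axis 4 1 = e1 p - \<alpha> p *\<^sub>R \<theta> p" using e1_unit_and_axis(2)[OF p] by simp
  show ?thesis
    unfolding theta_deriv_ambient[OF p v] a mink_e1[OF p v]
    by (subst (1) tangent_expansion[OF p v]) (simp add: algebra_simps)
qed

text \<open>
  Only \<open>\<alpha> \<theta>\<close> contributes to the derivative of \<open>e1 = \<partial>\<^sub>4 + \<alpha> \<theta>\<close>.
\<close>

lemma e1_deriv:
  assumes p: "p \<in> points M" and v: "v \<in> tangent_space M p"
  shows "dir_deriv M p v e1 =
    (mink v (e1 p) * \<epsilon> p + mink v (e2 p) * \<gamma> p) *\<^sub>R \<theta> p + (\<alpha> p * mink v (e2 p)) *\<^sub>R e2 p"
proof -
  note s = dir_deriv_scaleR[OF p mdiffs(4)[OF p] theta_mdiff[OF p]]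
  have "dir_deriv M p v e1 = dir_deriv M p v (\<lambda>q. axis 4 1 + \<alpha> q *\<^sub>R \<theta> q)"
    by (rule dir_deriv_cong(2)[OF openin_points p e1_unit_and_axis(2)[symmetric]
          dir_deriv_add(1)[OF p dir_deriv_const(1)[OF p] s(1)] v])
  also have "\<dots> = \<alpha> p *\<^sub>R dir_deriv M p v \<theta> + dir_deriv M p v \<alpha> *\<^sub>R \<theta> p"
    using dir_deriv_add(2)[OF p dir_deriv_const(1)[OF p] s(1) v, of "axis 4 1"] s(2)[OF v]
      dir_deriv_const(2)[OF p v, of "axis 4 (1::real) :: real^4"] by simp
  finally show ?thesis
    unfolding theta_deriv[OF p v] alpha_deriv[OF p v] by (simp add: algebra_simps power2_eq_square)
qed

text \<open>
  The products with \<open>e1\<close>, \<open>e2\<close>, \<open>\<theta>\<close> follow from the derivatives of the constant products of the frame. The product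
  \<open>b\<close> with \<open>\<xi>\<close> is linear in \<open>v\<close>; at \<open>e2\<close> it is \<open>\<beta>\<close>, and at \<open>e1\<close> it is found from the symmetry of \<open>h\<close>,
  that is, from the tangency of \<open>D\<^sub>e\<^sub>1 e2 - D\<^sub>e\<^sub>2 e1\<close>.
\<close>

lemma e2_deriv:
  assumes p: "p \<in> points M" and v: "v \<in> tangent_space M p"
  shows "dir_deriv M p v e2 =
    (mink v (e1 p) * \<gamma> p - mink v (e2 p) * \<beta> p) *\<^sub>R \<theta> p + mink v (e2 p) *\<^sub>R \<xi> p
     - (\<alpha> p * mink v (e2 p)) *\<^sub>R e1 p"
proof -
  note T = e1_T[OF p] e2_T[OF p] and m = mdiffs[OF p] and fp = frame_products[OF p]
  define b where "b = (\<lambda>w. mink (dir_deriv M p w e2) (\<xi> p))"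
  have "b (e1 p) = - \<gamma> p"
  proof -
    have "dir_deriv M p (e1 p) e2 - dir_deriv M p (e2 p) e1 \<in> tangent_space M p"
      by (rule dir_deriv_commute(1)[OF openin_points p e1_tangent e2_tangent])
    from xi_perp[OF p this] show ?thesis
      unfolding e1_deriv[OF p T(2)] by (simp add: b_def mink_commute[of "\<xi> p"] mink_simps fp)
  qed
  moreover have "b (e2 p) = \<beta> p"
  proof -
    have "mink (dir_deriv M p (e2 p) e2) (\<xi> p) = - mink (e2 p) (dir_deriv M p (e2 p) \<xi>)"
      by (rule mink_const_deriv[OF openin_points p m(2,3) frame_products(16) T(2)])
    then show ?thesis
      using mink_tan_part[OF p T(2)] beta_eq[OF p]
      by (simp add: b_def shape_op_def mink_simps mink_commute)
  qed
  moreover have "b v = mink v (e1 p) * b (e1 p) + mink v (e2 p) * b (e2 p)"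
  proof -
    have s: "r *\<^sub>R e1 p \<in> tangent_space M p" "r *\<^sub>R e2 p \<in> tangent_space M p" for r
      by (intro subspace_scale tangent_space_subspace p T)+
    have "b v = b (mink v (e1 p) *\<^sub>R e1 p + mink v (e2 p) *\<^sub>R e2 p)"
      using tangent_expansion[OF p v] by simp
    then show ?thesis
      using dir_deriv_linear(1)[OF p m(2) s(1) s(2)] dir_deriv_linear(2)[OF p m(2) T(1) T(1)]
        dir_deriv_linear(2)[OF p m(2) T(2) T(2)] by (simp add: b_def mink_simps)
  qed
  ultimately have b: "mink (dir_deriv M p v e2) (\<xi> p) = - mink v (e1 p) * \<gamma> p + mink v (e2 p) * \<beta> p"
    by (simp add: b_def)
  have 1: "mink (dir_deriv M p v e2) (e1 p) = - \<alpha> p * mink v (e2 p)"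
    using mink_const_deriv[OF openin_points p m(2,1) frame_products(4) v]
    by (simp add: e1_deriv[OF p v] mink_simps fp)
  have 2: "mink (dir_deriv M p v e2) (e2 p) = 0"
    using mink_const_deriv[OF openin_points p m(2,2) e2_unit v] by (simp add: mink_commute)
  have 3: "mink (dir_deriv M p v e2) (\<theta> p) = - mink v (e2 p)"
    using mink_const_deriv[OF openin_points p m(2) theta_mdiff[OF p] frame_products(14) v]
    by (simp add: theta_deriv[OF p v] mink_simps fp)
  show ?thesis
    by (subst frame_expansion[OF p, of "dir_deriv M p v e2"]) (simp add: 1 2 3 b algebra_simps)
qed

lemma xi_deriv:
  assumes p: "p \<in> points M" and v: "v \<in> tangent_space M p"
  shows "dir_deriv M p v \<xi> =
    (mink v (e1 p) * \<epsilon> p + mink v (e2 p) * \<gamma> p) *\<^sub>R e1 p +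
    (mink v (e1 p) * \<gamma> p - mink v (e2 p) * \<beta> p) *\<^sub>R e2 p - (\<alpha> p * mink v (e1 p)) *\<^sub>R \<xi> p"
proof -
  note m = mdiffs[OF p] and fp = frame_products[OF p]
  have 1: "mink (dir_deriv M p v \<xi>) (e1 p) = mink v (e1 p) * \<epsilon> p + mink v (e2 p) * \<gamma> p"
    using mink_const_deriv[OF openin_points p m(3,1) frame_products(11) v]
    by (simp add: e1_deriv[OF p v] mink_simps fp)
  have 2: "mink (dir_deriv M p v \<xi>) (e2 p) = mink v (e1 p) * \<gamma> p - mink v (e2 p) * \<beta> p"
    using mink_const_deriv[OF openin_points p m(3,2) frame_products(12) v]
    by (simp add: e2_deriv[OF p v] mink_simps fp)
  have 3: "mink (dir_deriv M p v \<xi>) (\<xi> p) = 0"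
    using mink_const_deriv[OF openin_points p m(3,3) xi_null v] by (simp add: mink_commute)
  have 4: "mink (dir_deriv M p v \<xi>) (\<theta> p) = \<alpha> p * mink v (e1 p)"
    using mink_const_deriv[OF openin_points p m(3) theta_mdiff[OF p] frame_products(7) v]
    by (simp add: theta_deriv[OF p v] mink_simps fp)
  show ?thesis
    by (subst frame_expansion[OF p, of "dir_deriv M p v \<xi>"]) (simp add: 1 2 3 4 algebra_simps)
qed

end

section \<open>Second fundamental form, mean curvature and curvatures\<close>

text \<open>
  An orthogonal matrix has the rows \<open>(a, b)\<close> and \<open>\<delta> (- b, a)\<close> with \<open>\<delta>\<close> its determinant.
\<close>

lemma orthonormal_rows_columns:
  fixes a b c d :: real
  assumes "a * a + b * b = 1" "c * c + d * d = 1" "a * c + b * d = 0"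
  shows "a * a + c * c = 1" "b * b + d * d = 1" "a * b + c * d = 0" "(a * d - b * c)^2 = 1"
proof -
  define \<delta> where "\<delta> = a * d - b * c"
  have "\<delta> * a = (a * a) * d - b * (a * c)" by (simp add: \<delta>_def algebra_simps)
  also have "\<dots> = (a * a + b * b) * d" using assms(3) by algebra
  finally have d: "d = \<delta> * a" using assms(1) by simp
  have "- \<delta> * b = (b * b) * c - a * (b * d)" by (simp add: \<delta>_def algebra_simps)
  also have "\<dots> = (a * a + b * b) * c" using assms(3) by algebra
  finally have c: "c = - \<delta> * b" using assms(1) by simp
  have "c * c + d * d = \<delta>^2 * (a * a + b * b)" unfolding c d by algebra
  then have \<delta>: "\<delta>^2 = 1" using assms by simp
  then show "(a * d - b * c)^2 = 1" by (simp add: \<delta>_def)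
  have "a * a + c * c = a * a + \<delta>^2 * (b * b)" "b * b + d * d = b * b + \<delta>^2 * (a * a)"
    "a * b + c * d = a * b - \<delta>^2 * (a * b)"
    unfolding c d by algebra+
  then show "a * a + c * c = 1" "b * b + d * d = 1" "a * b + c * d = 0"
    unfolding \<delta> using assms(1) by simp_all
qed

context cone_surface
begin

text \<open>
  The second fundamental form as a symmetric bilinear form on each tangent plane.
\<close>

definition \<sigma> :: "'a \<Rightarrow> real^4 \<Rightarrow> real^4 \<Rightarrow> real^4" where
  "\<sigma> p v w =
    (\<epsilon> p * (mink v (e1 p) * mink w (e1 p)) +
     \<gamma> p * (mink v (e1 p) * mink w (e2 p) + mink v (e2 p) * mink w (e1 p)) -
     \<beta> p * (mink v (e2 p) * mink w (e2 p))) *\<^sub>R \<theta> p +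
    (mink v (e2 p) * mink w (e2 p)) *\<^sub>R \<xi> p"

lemma second_ff_eq:
  assumes U: "openin (surf_top M) U" "p \<in> U" and v: "X p \<in> tangent_space M p" and Y: "tangent_field M U Y"
  shows "second_ff M X Y p = \<sigma> p (X p) (Y p)"
proof -
  have p: "p \<in> points M" and Up: "\<And>q. q \<in> U \<Longrightarrow> q \<in> points M" using U open_subset_points by auto
  note m = tangent_fieldD(2)[OF Y U(2)] and fp = frame_products[OF p]
  have 1: "mink (dir_deriv M p (X p) Y) (\<theta> p) = - (mink (X p) (e2 p) * mink (Y p) (e2 p))"
    using mink_const_deriv[OF U m theta_mdiff[OF p] _ v, of 0]
      theta_perp[OF Up tangent_fieldD(1)[OF Y]] theta_perp[OF p tangent_fieldD(1)[OF Y U(2)]]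
    by (simp add: theta_deriv[OF p v] mink_simps mink_commute[of _ "\<theta> _"])
  have 2: "mink (dir_deriv M p (X p) Y) (\<xi> p) =
    - ((mink (X p) (e1 p) * \<epsilon> p + mink (X p) (e2 p) * \<gamma> p) * mink (Y p) (e1 p) +
       (mink (X p) (e1 p) * \<gamma> p - mink (X p) (e2 p) * \<beta> p) * mink (Y p) (e2 p))"
    using mink_const_deriv[OF U m mdiffs(3)[OF p] _ v, of 0]
      xi_perp[OF Up tangent_fieldD(1)[OF Y]] xi_perp[OF p tangent_fieldD(1)[OF Y U(2)]]
    by (simp add: xi_deriv[OF p v] mink_simps mink_commute[of _ "\<xi> _"])
  show ?thesis
    unfolding second_ff_def nor_part_frame[OF p] 1 2 \<sigma>_def by (simp add: algebra_simps)
qed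

lemma orthonormal_frame_components:
  assumes U: "openin (surf_top M) U" "p \<in> U" and E: "orthonormal_frame M U E1 E2"
  defines "a \<equiv> mink (E1 p) (e1 p)" and "b \<equiv> mink (E1 p) (e2 p)"
    and "c \<equiv> mink (E2 p) (e1 p)" and "d \<equiv> mink (E2 p) (e2 p)"
  shows "a * a + b * b = 1" "c * c + d * d = 1" "a * c + b * d = 0"
proof -
  have p: "p \<in> points M" using U open_subset_points by auto
  have E1: "E1 p \<in> tangent_space M p" and E2: "E2 p \<in> tangent_space M p"
    and o: "mink (E1 p) (E1 p) = 1" "mink (E2 p) (E2 p) = 1" "mink (E1 p) (E2 p) = 0"
    using E U(2) by (auto simp: orthonormal_frame_def tangent_field_def)
  have "mink v w = mink v (e1 p) * mink w (e1 p) + mink v (e2 p) * mink w (e2 p)"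
    if v: "v \<in> tangent_space M p" for v w
    by (subst tangent_expansion[OF p v]) (simp add: mink_simps mink_commute)
  note e = this[OF E1, of "E1 p"] this[OF E2, of "E2 p"] this[OF E1, of "E2 p"]
  show "a * a + b * b = 1" "c * c + d * d = 1" "a * c + b * d = 0"
    using e o by (simp_all add: a_def b_def c_def d_def)
qed

text \<open>
  The trace of \<open>\<sigma>\<close> is the same in every orthonormal frame because the matrix of the frame with respect to
  \<open>e1\<close>, \<open>e2\<close> is orthogonal, so that its columns are orthonormal as well.
\<close>

lemma mean_curv_eq:
  assumes p: "p \<in> points M"
  shows "mean_curv M p = (1/2) *\<^sub>R ((\<epsilon> p - \<beta> p) *\<^sub>R \<theta> p + \<xi> p)"
proof -
  have trace: "second_ff M E1 E1 p + second_ff M E2 E2 p = (\<epsilon> p - \<beta> p) *\<^sub>R \<theta> p + \<xi> p"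
    if U: "openin (surf_top M) U" "p \<in> U" and E: "orthonormal_frame M U E1 E2" for U E1 E2
  proof -
    have t: "tangent_field M U E1" "tangent_field M U E2" using E by (auto simp: orthonormal_frame_def)
    note o = orthonormal_rows_columns[OF orthonormal_frame_components[OF U E]]
    have "\<sigma> p (E1 p) (E1 p) + \<sigma> p (E2 p) (E2 p) =
      (\<epsilon> p * (mink (E1 p) (e1 p) * mink (E1 p) (e1 p) + mink (E2 p) (e1 p) * mink (E2 p) (e1 p)) +
       2 * \<gamma> p * (mink (E1 p) (e1 p) * mink (E1 p) (e2 p) + mink (E2 p) (e1 p) * mink (E2 p) (e2 p)) -
       \<beta> p * (mink (E1 p) (e2 p) * mink (E1 p) (e2 p) + mink (E2 p) (e2 p) * mink (E2 p) (e2 p))) *\<^sub>R \<theta> p +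
      (mink (E1 p) (e2 p) * mink (E1 p) (e2 p) + mink (E2 p) (e2 p) * mink (E2 p) (e2 p)) *\<^sub>R \<xi> p"
      by (simp add: \<sigma>_def algebra_simps)
    then show ?thesis
      unfolding o(1,2,3) second_ff_eq[where X = E1, OF U tangent_fieldD(1)[OF t(1) U(2)] t(1)]
        second_ff_eq[where X = E2, OF U tangent_fieldD(1)[OF t(2) U(2)] t(2)] by simp
  qed
  show ?thesis
    unfolding mean_curv_def
  proof (rule the_equality)
    show "\<exists>U E1 E2. openin (surf_top M) U \<and> p \<in> U \<and> orthonormal_frame M U E1 E2 \<and>
      (1/2) *\<^sub>R ((\<epsilon> p - \<beta> p) *\<^sub>R \<theta> p + \<xi> p) = (1/2) *\<^sub>R (second_ff M E1 E1 p + second_ff M E2 E2 p)"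
      using openin_points p frame trace[OF openin_points p frame]
      by (intro exI[of _ "points M"] exI[of _ e1] exI[of _ e2]) simp
  next
    fix \<eta>
    assume "\<exists>U E1 E2. openin (surf_top M) U \<and> p \<in> U \<and> orthonormal_frame M U E1 E2 \<and>
      \<eta> = (1/2) *\<^sub>R (second_ff M E1 E1 p + second_ff M E2 E2 p)"
    then show "\<eta> = (1/2) *\<^sub>R ((\<epsilon> p - \<beta> p) *\<^sub>R \<theta> p + \<xi> p)"
      using trace by auto
  qed
qed

text \<open>
  The product rule for \<open>(\<epsilon> - \<beta>) \<theta>\<close> requires differentiable coefficients. The function \<open>\<beta>\<close> is
  given only pointwise, but it equals \<open>\<langle>D\<^sub>e\<^sub>2 e2, \<xi>\<rangle>\<close>, a product of differentiable fields.
\<close>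

lemma epsilon_beta_mdiff:
  assumes p: "p \<in> points M"
  shows "mdiff M p (\<lambda>q. \<epsilon> q - \<beta> q)"
proof -
  note m = mdiffs[OF p]
  have e: "mdiff M p \<epsilon>"
    unfolding \<epsilon>_def[abs_def] power2_eq_square
    by (rule dir_deriv_add(1)[OF p mdiff_dir_deriv[OF openin_points p e1_tangent alpha_smooth]
          dir_deriv_mult(1)[OF p m(4) m(4)]])
  have e2s: "smooth_map_on M (points M) e2" using e2_tangent by (simp add: tangent_field_def)
  have "mdiff M p (\<lambda>q. mink (dir_deriv M q (e2 q) e2) (\<xi> q))"
    by (rule dir_deriv_mink(1)[OF p mdiff_dir_deriv[OF openin_points p e2_tangent e2s] m(3)])
  moreover have "mink (dir_deriv M q (e2 q) e2) (\<xi> q) = \<beta> q" if q: "q \<in> points M" for q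
    unfolding e2_deriv[OF q e2_T[OF q]] by (simp add: mink_simps frame_products[OF q])
  ultimately have "mdiff M p \<beta>"
    using dir_deriv_cong(1)[OF openin_points p, of "\<lambda>q. mink (dir_deriv M q (e2 q) e2) (\<xi> q)" \<beta>] by simp
  from dir_deriv_diff(1)[OF p e this] show ?thesis .
qed

text \<open>
  In the derivative of \<open>(\<epsilon> - \<beta>) \<theta> + \<xi>\<close> the derivative of the coefficient multiplies the normal
  vector \<open>\<theta>\<close> and so drops out of the tangential part.
\<close>

lemma shape_mean_curv:
  assumes p: "p \<in> points M" and v: "v \<in> tangent_space M p"
  shows "shape_op M (mean_curv M) p v = - (1/2) *\<^sub>R
    ((mink v (e1 p) * \<epsilon> p + mink v (e2 p) * \<gamma> p) *\<^sub>R e1 p +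
     (mink v (e1 p) * \<gamma> p + mink v (e2 p) * (\<epsilon> p - 2 * \<beta> p)) *\<^sub>R e2 p)"
proof -
  note fp = frame_products[OF p]
  let ?k = "\<lambda>q. \<epsilon> q - \<beta> q"
  let ?N = "\<lambda>q. ?k q *\<^sub>R \<theta> q + \<xi> q"
  note s = dir_deriv_scaleR[OF p epsilon_beta_mdiff[OF p] theta_mdiff[OF p]]
  note N = dir_deriv_add[OF p s(1) mdiffs(3)[OF p]]
  note L = dir_deriv_bounded_linear[OF bounded_linear_scaleR_right[of "1/2"] p N(1)]
  have "dir_deriv M p v (mean_curv M) = dir_deriv M p v (\<lambda>q. (1/2) *\<^sub>R ?N q)"
    by (rule dir_deriv_cong(2)[OF openin_points p mean_curv_eq[symmetric] L(1) v])
  also have "\<dots> = (1/2) *\<^sub>R (?k p *\<^sub>R dir_deriv M p v \<theta> + dir_deriv M p v ?k *\<^sub>R \<theta> p + dir_deriv M p v \<xi>)"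
    unfolding L(2)[OF v] N(2)[OF v] s(2)[OF v] ..
  finally have D: "dir_deriv M p v (mean_curv M) =
    (1/2) *\<^sub>R (?k p *\<^sub>R dir_deriv M p v \<theta> + dir_deriv M p v ?k *\<^sub>R \<theta> p + dir_deriv M p v \<xi>)" .
  have m: "mink (dir_deriv M p v (mean_curv M)) (e1 p) = (1/2) * (mink v (e1 p) * \<epsilon> p + mink v (e2 p) * \<gamma> p)"
    "mink (dir_deriv M p v (mean_curv M)) (e2 p) =
       (1/2) * (mink v (e1 p) * \<gamma> p + mink v (e2 p) * (\<epsilon> p - 2 * \<beta> p))"
    unfolding D theta_deriv[OF p v] xi_deriv[OF p v]
    by (simp_all only: mink_simps fp) (simp_all add: algebra_simps)
  show ?thesis
    unfolding shape_op_def tan_part_frame[OF p] m by (simp add: scaleR_add_right)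
qed

text \<open>
  For \<open>\<gamma> = \<beta> = 0\<close> the structure equations give \<open>D\<^sub>e\<^sub>1 e2 = 0\<close>, \<open>D\<^sub>e\<^sub>2 e2 = \<xi> - \<alpha> e1\<close> and
  \<open>[e1, e2] = - \<alpha> e2\<close>. Commuting the derivatives of \<open>e2\<close> therefore yields
  \<open>D\<^sub>e\<^sub>1 (\<xi> - \<alpha> e1) = - \<alpha> (\<xi> - \<alpha> e1)\<close>, whose product with \<open>\<xi>\<close> is \<open>\<alpha> \<epsilon> = 0\<close>.
\<close>

lemma codazzi:
  assumes gb: "\<And>q. q \<in> points M \<Longrightarrow> \<gamma> q = 0 \<and> \<beta> q = 0" and p: "p \<in> points M"
  shows "\<epsilon> p = 0"
proof -
  note T = e1_T[OF p] e2_T[OF p] and m = mdiffs[OF p] and fp = frame_products[OF p]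
  have e2s: "smooth_map_on M (points M) e2" using e2_tangent by (simp add: tangent_field_def)
  let ?F = "\<lambda>q. \<xi> q - \<alpha> q *\<^sub>R e1 q"
  note s = dir_deriv_scaleR[OF p m(4,1)]
  note F = dir_deriv_diff[OF p m(3) s(1)]
  have 22: "?F q = dir_deriv M q (e2 q) e2" if q: "q \<in> points M" for q
    unfolding e2_deriv[OF q e2_T[OF q]] by (simp add: frame_products[OF q] gb[OF q])
  have 12: "0 = dir_deriv M q (e1 q) e2" if q: "q \<in> points M" for q
    unfolding e2_deriv[OF q e1_T[OF q]] by (simp add: frame_products[OF q] gb[OF q])
  have "dir_deriv M p (e1 p) (\<lambda>q. dir_deriv M q (e2 q) e2) = dir_deriv M p (e1 p) ?F"
    by (rule dir_deriv_cong(2)[OF openin_points p 22 F(1) T(1)])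
  moreover have "dir_deriv M p (e2 p) (\<lambda>q. dir_deriv M q (e1 q) e2) = 0"
    using dir_deriv_cong(2)[OF openin_points p 12 dir_deriv_const(1)[OF p] T(2)]
      dir_deriv_const(2)[OF p T(2), of "0 :: real^4"] by simp
  moreover have "dir_deriv M p (e1 p) e2 - dir_deriv M p (e2 p) e1 = (- \<alpha> p) *\<^sub>R e2 p"
    unfolding e1_deriv[OF p T(2)] 12[OF p, symmetric] by (simp add: fp gb[OF p])
  ultimately have "dir_deriv M p (e1 p) ?F = dir_deriv M p ((- \<alpha> p) *\<^sub>R e2 p) e2"
    using dir_deriv_commute(2)[OF openin_points p e1_tangent e2_tangent e2s] by simp
  also have "\<dots> = (- \<alpha> p) *\<^sub>R ?F p"
    unfolding dir_deriv_linear(2)[OF p m(2) T(2) T(2)] 22[OF p, symmetric] ..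
  finally have "dir_deriv M p (e1 p) \<xi> -
      (\<alpha> p *\<^sub>R dir_deriv M p (e1 p) e1 + dir_deriv M p (e1 p) \<alpha> *\<^sub>R e1 p) = (- \<alpha> p) *\<^sub>R ?F p"
    unfolding F(2)[OF T(1)] s(2)[OF T(1)] .
  then have "mink (dir_deriv M p (e1 p) \<xi> -
      (\<alpha> p *\<^sub>R dir_deriv M p (e1 p) e1 + dir_deriv M p (e1 p) \<alpha> *\<^sub>R e1 p)) (\<xi> p) = mink ((- \<alpha> p) *\<^sub>R ?F p) (\<xi> p)"
    by simp
  then have "\<alpha> p * \<epsilon> p = 0"
    unfolding e1_deriv[OF p T(1)] xi_deriv[OF p T(1)] by (simp add: mink_simps fp)
  then show ?thesis using alpha_nonzero[OF p] by simp
qed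

lemma tan_part_mdiff:
  assumes p: "p \<in> points M" and F: "mdiff M p F"
  shows "mdiff M p (\<lambda>q. tan_part M q (F q))"
proof -
  note m = mdiffs[OF p]
  have "mdiff M p (\<lambda>q. mink (F q) (e1 q) *\<^sub>R e1 q + mink (F q) (e2 q) *\<^sub>R e2 q)"
    by (rule dir_deriv_add(1)[OF p dir_deriv_scaleR(1)[OF p dir_deriv_mink(1)[OF p F m(1)] m(1)]
          dir_deriv_scaleR(1)[OF p dir_deriv_mink(1)[OF p F m(2)] m(2)]])
  from dir_deriv_cong(1)[OF openin_points p tan_part_frame[symmetric] this] show ?thesis .
qed

lemma nor_part_mdiff:
  assumes p: "p \<in> points M" and F: "mdiff M p F"
  shows "mdiff M p (\<lambda>q. nor_part M q (F q))"
  unfolding nor_part_def by (rule dir_deriv_diff(1)[OF p F tan_part_mdiff[OF p F]])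

lemma dir_deriv_split:
  assumes p: "p \<in> points M" and F: "mdiff M p F" and v: "v \<in> tangent_space M p"
  shows "dir_deriv M p v F = dir_deriv M p v (\<lambda>q. tan_part M q (F q)) + dir_deriv M p v (\<lambda>q. nor_part M q (F q))"
  using dir_deriv_add(2)[OF p tan_part_mdiff[OF p F] nor_part_mdiff[OF p F] v]
  by (simp add: nor_part_def)

lemma mink_split:
  assumes p: "p \<in> points M"
  shows "mink (tan_part M p w) (nor_part M p z) = 0" "mink (nor_part M p w) (tan_part M p z) = 0"
    "mink (tan_part M p w) z = mink (tan_part M p w) (tan_part M p z)"
    "mink (nor_part M p w) z = mink (nor_part M p w) (nor_part M p z)"
proof -
  note n = mink_nor_part[OF p tan_part_props(1)[OF p]]
  show 1: "mink (nor_part M p w) (tan_part M p z) = 0" for w z by (rule n)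
  show 2: "mink (tan_part M p w) (nor_part M p z) = 0" for w z using n by (simp add: mink_commute)
  have z: "z = tan_part M p z + nor_part M p z" by (simp add: nor_part_def)
  show "mink (tan_part M p w) z = mink (tan_part M p w) (tan_part M p z)"
    by (subst z) (simp add: mink_simps 2)
  show "mink (nor_part M p w) z = mink (nor_part M p w) (nor_part M p z)"
    by (subst z) (simp add: mink_simps 1)
qed

text \<open>
  The projected second derivative differs from the ambient one by the derivative of the complementary
  part, which is orthogonal to \<open>W\<close>; moving the derivative to \<open>W\<close> turns it into a product of first
  derivatives. The first version underlies the Gauss equation, the second the Ricci equation.
\<close>

lemma second_covariant_derivative:
  assumes U: "openin (surf_top M) U" "p \<in> U" and Y: "tangent_field M U Y"
    and v: "v \<in> tangent_space M p" and F: "smooth_map_on M U F" and W: "mdiff M p W"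
  shows "(\<And>q. q \<in> U \<Longrightarrow> W q \<in> tangent_space M q) \<Longrightarrow>
      mink (tan_part M p (dir_deriv M p v (\<lambda>q. tan_part M q (dir_deriv M q (Y q) F)))) (W p) =
      mink (dir_deriv M p v (\<lambda>q. dir_deriv M q (Y q) F)) (W p) +
      mink (nor_part M p (dir_deriv M p (Y p) F)) (nor_part M p (dir_deriv M p v W))"
    and "(\<And>q u. q \<in> U \<Longrightarrow> u \<in> tangent_space M q \<Longrightarrow> mink (W q) u = 0) \<Longrightarrow>
      mink (nor_part M p (dir_deriv M p v (\<lambda>q. nor_part M q (dir_deriv M q (Y q) F)))) (W p) =
      mink (dir_deriv M p v (\<lambda>q. dir_deriv M q (Y q) F)) (W p) +
      mink (tan_part M p (dir_deriv M p (Y p) F)) (tan_part M p (dir_deriv M p v W))"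
proof -
  have p: "p \<in> points M" and Up: "\<And>q. q \<in> U \<Longrightarrow> q \<in> points M" using U open_subset_points by auto
  let ?D = "\<lambda>q. dir_deriv M q (Y q) F"
  have D: "mdiff M p ?D" by (rule mdiff_dir_deriv[OF U Y F])
  note split = dir_deriv_split[OF p D v]
  {
    assume WT: "\<And>q. q \<in> U \<Longrightarrow> W q \<in> tangent_space M q"
    have "mink (dir_deriv M p v (\<lambda>q. nor_part M q (?D q))) (W p) = - mink (nor_part M p (?D p)) (dir_deriv M p v W)"
      by (rule mink_const_deriv[OF U nor_part_mdiff[OF p D] W mink_nor_part[OF Up WT] v])
    then show "mink (tan_part M p (dir_deriv M p v (\<lambda>q. tan_part M q (?D q)))) (W p) =
      mink (dir_deriv M p v ?D) (W p) + mink (nor_part M p (?D p)) (nor_part M p (dir_deriv M p v W))"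
      unfolding mink_tan_part[OF p WT[OF U(2)]] split mink_simps mink_split(4)[OF p, symmetric] by simp
  next
    assume WN: "\<And>q u. q \<in> U \<Longrightarrow> u \<in> tangent_space M q \<Longrightarrow> mink (W q) u = 0"
    have "mink (dir_deriv M p v (\<lambda>q. tan_part M q (?D q))) (W p) = - mink (tan_part M p (?D p)) (dir_deriv M p v W)"
      by (rule mink_const_deriv[where k = 0, OF U tan_part_mdiff[OF p D] W _ v])
        (simp add: mink_commute[of "tan_part M _ _"] WN tan_part_props(1)[OF Up])
    moreover have "mink (nor_part M p w) (W p) = mink w (W p)" for w
      using WN[OF U(2) tan_part_props(1)[OF p, of w]] by (simp add: nor_part_def mink_simps mink_commute)
    ultimately show "mink (nor_part M p (dir_deriv M p v (\<lambda>q. nor_part M q (?D q)))) (W p) =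
      mink (dir_deriv M p v ?D) (W p) + mink (tan_part M p (?D p)) (tan_part M p (dir_deriv M p v W))"
      unfolding split mink_simps mink_split(3)[OF p, symmetric] by simp
  }
qed

lemma gauss_equation:
  assumes U: "openin (surf_top M) U" "p \<in> U" and X: "tangent_field M U X" and Y: "tangent_field M U Y"
    and Z: "tangent_field M U Z" and W: "tangent_field M U W"
  shows "mink (riem_curv M X Y Z p) (W p) =
    mink (second_ff M Y Z p) (second_ff M X W p) - mink (second_ff M X Z p) (second_ff M Y W p)"
proof -
  have p: "p \<in> points M" using U open_subset_points by auto
  note XT = tangent_fieldD(1)[OF X U(2)] and YT = tangent_fieldD(1)[OF Y U(2)]
  note WT = tangent_fieldD(1)[OF W U(2)]
  have Zs: "smooth_map_on M U Z" using Z by (simp add: tangent_field_def)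
  note c = second_covariant_derivative(1)[OF U _ _ Zs tangent_fieldD(2)[OF W U(2)] tangent_fieldD(1)[OF W]]
  show ?thesis
    using c[OF Y XT] c[OF X YT]
    unfolding riem_curv_def conn_def second_ff_def lie_bracket_eq[OF U X Y] mink_tan_part[OF p WT]
      dir_deriv_commute(2)[OF U X Y Zs, symmetric] mink_simps
    by linarith
qed

lemma ricci_equation:
  assumes U: "openin (surf_top M) U" "p \<in> U" and X: "tangent_field M U X" and Y: "tangent_field M U Y"
    and \<zeta>: "normal_field M U \<zeta>" and \<eta>: "normal_field M U \<eta>"
  shows "mink (normal_curv M X Y \<zeta> p) (\<eta> p) =
    mink (tan_part M p (dir_deriv M p (Y p) \<zeta>)) (tan_part M p (dir_deriv M p (X p) \<eta>)) -
    mink (tan_part M p (dir_deriv M p (X p) \<zeta>)) (tan_part M p (dir_deriv M p (Y p) \<eta>))"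
proof -
  have p: "p \<in> points M" using U open_subset_points by auto
  note XT = tangent_fieldD(1)[OF X U(2)] and YT = tangent_fieldD(1)[OF Y U(2)]
  have Zs: "smooth_map_on M U \<zeta>" using \<zeta> by (simp add: normal_field_def)
  note c = second_covariant_derivative(2)[OF U _ _ Zs normal_fieldD(2)[OF \<eta> U(2)] normal_fieldD(1)[OF \<eta>]]
  have n: "mink (nor_part M p w) (\<eta> p) = mink w (\<eta> p)" for w
    using normal_fieldD(1)[OF \<eta> U(2) tan_part_props(1)[OF p, of w]]
    by (simp add: nor_part_def mink_simps mink_commute)
  show ?thesis
    using c[OF Y XT] c[OF X YT]
    unfolding normal_curv_def normal_conn_def lie_bracket_eq[OF U X Y] n
      dir_deriv_commute(2)[OF U X Y Zs, symmetric] mink_simps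
    by linarith
qed

text \<open>
  The Gauss equation expresses the curvature in any orthonormal frame through \<open>\<sigma>\<close>, and there it is
  \<open>- \<epsilon>\<close> times the squared determinant of the frame with respect to \<open>e1\<close>, \<open>e2\<close>.
\<close>

lemma gauss_curv_eq:
  assumes p: "p \<in> points M"
  shows "gauss_curv M p = - \<epsilon> p"
proof -
  note fp = frame_products[OF p]
  have K: "mink (riem_curv M E1 E2 E2 p) (E1 p) = - \<epsilon> p"
    if U: "openin (surf_top M) U" "p \<in> U" and E: "orthonormal_frame M U E1 E2" for U E1 E2
  proof -
    have t: "tangent_field M U E1" "tangent_field M U E2" using E by (auto simp: orthonormal_frame_def)
    note T = tangent_fieldD(1)[OF t(1) U(2)] tangent_fieldD(1)[OF t(2) U(2)]
    have "mink (riem_curv M E1 E2 E2 p) (E1 p) =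
      mink (\<sigma> p (E2 p) (E2 p)) (\<sigma> p (E1 p) (E1 p)) - mink (\<sigma> p (E1 p) (E2 p)) (\<sigma> p (E2 p) (E1 p))"
      unfolding gauss_equation[OF U t(1) t(2) t(2) t(1)]
        second_ff_eq[where X = E1, OF U T(1) t(1)] second_ff_eq[where X = E2, OF U T(2) t(2)]
        second_ff_eq[where X = E1, OF U T(1) t(2)] second_ff_eq[where X = E2, OF U T(2) t(1)] ..
    also have "\<dots> = - \<epsilon> p * (mink (E1 p) (e1 p) * mink (E2 p) (e2 p) - mink (E1 p) (e2 p) * mink (E2 p) (e1 p))^2"
      by (simp add: \<sigma>_def mink_simps fp) algebra
    finally show ?thesis
      unfolding orthonormal_rows_columns(4)[OF orthonormal_frame_components[OF U E]] by simp
  qed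
  show ?thesis
    unfolding gauss_curv_def
  proof (rule the_equality)
    show "\<exists>U E1 E2. openin (surf_top M) U \<and> p \<in> U \<and> orthonormal_frame M U E1 E2 \<and>
      - \<epsilon> p = mink (riem_curv M E1 E2 E2 p) (E1 p)"
      using openin_points p frame K[OF openin_points p frame]
      by (intro exI[of _ "points M"] exI[of _ e1] exI[of _ e2]) simp
  next
    fix k
    assume "\<exists>U E1 E2. openin (surf_top M) U \<and> p \<in> U \<and> orthonormal_frame M U E1 E2 \<and>
      k = mink (riem_curv M E1 E2 E2 p) (E1 p)"
    then show "k = - \<epsilon> p" using K by auto
  qed
qed

lemma normal_curv_frame:
  assumes p: "p \<in> points M"
  shows "mink (normal_curv M e1 e2 \<theta> p) (\<xi> p) = \<gamma> p"
  unfolding ricci_equation[OF openin_points p e1_tangent e2_tangent theta_normal xi_normal]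
    theta_deriv[OF p e1_T[OF p]] theta_deriv[OF p e2_T[OF p]]
    xi_deriv[OF p e1_T[OF p]] xi_deriv[OF p e2_T[OF p]] tan_part_frame[OF p]
  by (simp add: mink_simps frame_products[OF p])

text \<open>
  If \<open>\<epsilon> = \<gamma> = 0\<close>, the shape operators of all normal fields have their range in the line spanned by
  \<open>e2\<close> and annihilate \<open>e1\<close>; hence they commute and the right side of the Ricci equation vanishes.
\<close>

lemma flat_normal_bundle_if:
  assumes z: "\<And>q. q \<in> points M \<Longrightarrow> \<epsilon> q = 0 \<and> \<gamma> q = 0"
  shows "flat_normal_bundle M"
  unfolding flat_normal_bundle_def
proof (intro allI impI ballI)
  fix U X Y \<zeta> p
  assume *: "openin (surf_top M) U \<and> tangent_field M U X \<and> tangent_field M U Y \<and> normal_field M U \<zeta>"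
    and pU: "p \<in> U"
  then have U: "openin (surf_top M) U" "p \<in> U" and X: "tangent_field M U X" and Y: "tangent_field M U Y"
    and \<zeta>: "normal_field M U \<zeta>" by auto
  have p: "p \<in> points M" and UM: "U \<subseteq> points M" using U open_subset_points by auto
  note fp = frame_products[OF p]
  note XT = tangent_fieldD(1)[OF X U(2)] and YT = tangent_fieldD(1)[OF Y U(2)]
  have tan: "tan_part M p (dir_deriv M p v \<eta>) = (- mink v (e2 p) * mink (\<eta> p) (\<xi> p + (- \<beta> p) *\<^sub>R \<theta> p)) *\<^sub>R e2 p"
    if \<eta>: "normal_field M U \<eta>" and v: "v \<in> tangent_space M p" for \<eta> v
  proof -
    note m = normal_fieldD(2)[OF \<eta> U(2)] mdiffs[OF p]
    have "mink (\<eta> q) (e1 q) = 0" "mink (\<eta> q) (e2 q) = 0" if "q \<in> U" for q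
      using normal_fieldD(1)[OF \<eta> that] that UM e1_T e2_T by blast+
    then have "mink (dir_deriv M p v \<eta>) (e1 p) = - mink (\<eta> p) (dir_deriv M p v e1)"
      "mink (dir_deriv M p v \<eta>) (e2 p) = - mink (\<eta> p) (dir_deriv M p v e2)"
      and "mink (\<eta> p) (e1 p) = 0" "mink (\<eta> p) (e2 p) = 0"
      using mink_const_deriv[OF U m(1,2) _ v, of 0] mink_const_deriv[OF U m(1,3) _ v, of 0] U(2) by auto
    then have "mink (dir_deriv M p v \<eta>) (e1 p) = 0"
      "mink (dir_deriv M p v \<eta>) (e2 p) = - mink v (e2 p) * mink (\<eta> p) (\<xi> p + (- \<beta> p) *\<^sub>R \<theta> p)"
      unfolding e1_deriv[OF p v] e2_deriv[OF p v]
      by (simp_all add: z[OF p] mink_simps algebra_simps)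
    then show ?thesis unfolding tan_part_frame[OF p] by simp
  qed
  have R: "mink (normal_curv M X Y \<zeta> p) (\<eta> p) = 0" if \<eta>: "normal_field M U \<eta>" for \<eta>
    unfolding ricci_equation[OF U X Y \<zeta> \<eta>] tan[OF \<zeta> XT] tan[OF \<zeta> YT] tan[OF \<eta> XT] tan[OF \<eta> YT]
    by (simp add: mink_simps)
  have sub: "normal_field M U \<eta>" if "normal_field M (points M) \<eta>" for \<eta>
    using that UM by (auto simp: normal_field_def intro: smooth_map_on_subset)
  have T: "mink (normal_curv M X Y \<zeta> p) v = 0" if "v \<in> tangent_space M p" for v
    unfolding normal_curv_def normal_conn_def mink_simps by (simp add: mink_nor_part[OF p that])
  show "normal_curv M X Y \<zeta> p = 0"
    using frame_expansion[OF p, of "normal_curv M X Y \<zeta> p"] R[OF sub[OF theta_normal]] R[OF sub[OF xi_normal]]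
      T[OF e1_T[OF p]] T[OF e2_T[OF p]] by simp
qed

lemma mean_curv_light_like_iff:
  assumes p: "p \<in> points M"
  shows "light_like (mean_curv M p) \<longleftrightarrow> \<epsilon> p = \<beta> p"
proof -
  note fp = frame_products[OF p]
  have "mink (mean_curv M p) (\<theta> p) = - (1/2)" "mink (mean_curv M p) (mean_curv M p) = - (1/2) * (\<epsilon> p - \<beta> p)"
    unfolding mean_curv_eq[OF p] by (simp_all add: mink_simps fp field_simps)
  then show ?thesis unfolding light_like_def by (auto simp: mink_simps)
qed

lemma invariants_vanish_iff_trapped:
  "(\<forall>p\<in>points M. \<epsilon> p = 0 \<and> \<gamma> p = 0 \<and> \<beta> p = 0) \<longleftrightarrow>
    flat_surface M \<and> marginally_trapped M \<and> flat_normal_bundle M"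
proof
  assume "\<forall>p\<in>points M. \<epsilon> p = 0 \<and> \<gamma> p = 0 \<and> \<beta> p = 0"
  then show "flat_surface M \<and> marginally_trapped M \<and> flat_normal_bundle M"
    using flat_normal_bundle_if
    by (simp add: flat_surface_def marginally_trapped_def gauss_curv_eq mean_curv_light_like_iff)
next
  assume a: "flat_surface M \<and> marginally_trapped M \<and> flat_normal_bundle M"
  show "\<forall>p\<in>points M. \<epsilon> p = 0 \<and> \<gamma> p = 0 \<and> \<beta> p = 0"
  proof
    fix p assume p: "p \<in> points M"
    have "normal_curv M e1 e2 \<theta> p = 0"
      using a openin_points e1_tangent e2_tangent theta_normal p unfolding flat_normal_bundle_def by blast
    then show "\<epsilon> p = 0 \<and> \<gamma> p = 0 \<and> \<beta> p = 0"
      using a p normal_curv_frame[OF p] mean_curv_light_like_iff[OF p] gauss_curv_eq[OF p]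
      by (auto simp: flat_surface_def marginally_trapped_def mink_simps)
  qed
qed

lemma shape_vanishes_if:
  assumes "\<forall>p\<in>points M. \<epsilon> p = 0 \<and> \<gamma> p = 0 \<and> \<beta> p = 0" "p \<in> points M" "v \<in> tangent_space M p"
  shows "shape_op M (mean_curv M) p v = 0"
  using assms(1,2) by (simp add: shape_mean_curv[OF assms(2,3)])

lemma pseudo_umbilical_if_shape_vanishes:
  assumes "\<And>p v. p \<in> points M \<Longrightarrow> v \<in> tangent_space M p \<Longrightarrow> shape_op M (mean_curv M) p v = 0"
  shows "pseudo_umbilical M"
  unfolding pseudo_umbilical_def
  by (rule exI[of _ "\<lambda>q. 0"]) (simp add: smooth_map_on_const assms mink_simps)

text \<open>
  The diagonal entries of \<open>A\<^sub>H\<close> agree only if \<open>\<beta> = 0\<close>, and the other entry is a multiple of \<open>\<gamma>\<close>;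
  the Codazzi equation then gives \<open>\<epsilon> = 0\<close>.
\<close>

lemma invariants_vanish_if_pseudo_umbilical:
  assumes "pseudo_umbilical M"
  shows "\<forall>p\<in>points M. \<epsilon> p = 0 \<and> \<gamma> p = 0 \<and> \<beta> p = 0"
proof -
  obtain f :: "'a \<Rightarrow> real" where f: "\<And>p v w. p \<in> points M \<Longrightarrow> v \<in> tangent_space M p \<Longrightarrow>
    w \<in> tangent_space M p \<Longrightarrow> mink (shape_op M (mean_curv M) p v) w = f p * mink v w"
    using assms unfolding pseudo_umbilical_def by blast
  have gb: "\<gamma> p = 0 \<and> \<beta> p = 0" if p: "p \<in> points M" for p
  proof -
    note T = e1_T[OF p] e2_T[OF p] and fp = frame_products[OF p]
    show ?thesis
      using f[OF p T(1) T(1)] f[OF p T(1) T(2)] f[OF p T(2) T(2)]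
      unfolding shape_mean_curv[OF p T(1)] shape_mean_curv[OF p T(2)]
      by (simp add: mink_simps fp) (simp add: field_simps)
  qed
  then show ?thesis using codazzi by blast
qed

end

theorem proposition5p6:
  fixes M :: "'a surface"
    and e1 e2 \<theta> \<xi> :: "'a \<Rightarrow> real^4"
    and \<alpha> \<beta> :: "'a \<Rightarrow> real"
  assumes surface: "riemannian_surface M"
    and on_cone: "pos M ` points M \<subseteq> LC2_times_R"
    and theta: "\<theta> = theta_field M"
    and xi: "normal_field M (points M) \<xi>"
      "\<forall>p\<in>points M. mink (\<xi> p) (\<xi> p) = 0 \<and> mink (\<xi> p) (\<theta> p) = -1"
    and e1: "\<forall>p\<in>points M. e1 p = tan_part M p (axis 4 1)"
    and e2: "tangent_field M (points M) e2"
      "\<forall>p\<in>points M. mink (e2 p) (e2 p) = 1 \<and> mink (e1 p) (e2 p) = 0"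
    and alpha: "smooth_map_on M (points M) \<alpha>"
      "\<forall>p\<in>points M. normal_conn M e1 \<theta> p = \<alpha> p *\<^sub>R \<theta> p"
    and beta: "\<forall>p\<in>points M. \<beta> p = mink (shape_op M \<xi> p (e2 p)) (e2 p)"
    and alpha_nonzero: "\<forall>p\<in>points M. \<alpha> p \<noteq> 0"
  shows "(pseudo_umbilical M \<longleftrightarrow>
           (\<forall>p\<in>points M. dir_deriv M p (e1 p) \<alpha> + (\<alpha> p)^2 = 0 \<and>
              dir_deriv M p (e2 p) \<alpha> = 0 \<and> \<beta> p = 0)) \<and>
         (pseudo_umbilical M \<longleftrightarrow>
           flat_surface M \<and> marginally_trapped M \<and> flat_normal_bundle M) \<and>
         (pseudo_umbilical M \<longleftrightarrow>
           (\<forall>p\<in>points M. \<forall>v\<in>tangent_space M p. shape_op M (mean_curv M) p v = 0))"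
proof -
  interpret cone_surface M e1 e2 \<xi> \<alpha> \<beta>
    by unfold_locales (use assms in auto)
  have "pseudo_umbilical M \<longleftrightarrow> (\<forall>p\<in>points M. \<epsilon> p = 0 \<and> \<gamma> p = 0 \<and> \<beta> p = 0)"
    "pseudo_umbilical M \<longleftrightarrow> (\<forall>p\<in>points M. \<forall>v\<in>tangent_space M p. shape_op M (mean_curv M) p v = 0)"
    using invariants_vanish_if_pseudo_umbilical shape_vanishes_if pseudo_umbilical_if_shape_vanishes
    by metis+
  then show ?thesis
    using invariants_vanish_iff_trapped unfolding \<epsilon>_def \<gamma>_def by blast
qed

end
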